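(* For every real number $a>0$, $$\pi^3\, m\big((1+w)(1+x)+a(1-w)(y+z)\big)=-i\pi^2\,\mathcal{L}^a_2(i)+2i\,\mathcal{L}^a_{3,1}(i,i),$$ where the polynomial is in the four variables $w,x,y,z$.
   Context: The (logarithmic) Mahler measure of a nonzero polynomial $P\in\mathbb{C}[x_1,\dots,x_n]$ is $m(P)=\frac{1}{(2\pi i)^n}\int_{\mathbb{T}^n}\log|P(x_1,\dots,x_n)|\,\frac{dx_1}{x_1}\cdots\frac{dx_n}{x_n}$, with $\mathbb{T}^n=\{|x_1|=\dots=|x_n|=1\}$. Multiple polylogarithms: $\mathrm{Li}_{n_1,\dots,n_m}(x_1,\dots,x_m)=\sum_{0<k_1<\dots<k_m}\frac{x_1^{k_1}\cdots x_m^{k_m}}{k_1^{n_1}\cdots k_m^{n_m}}$ for $|x_i|<1$, extended by analytic continuation through $$\mathrm{Li}_{n_1,\dots,n_m}(x_1,\dots,x_m)=(-1)^m\,\mathrm{I}_{n_1,\dots,n_m}\big((x_1\cdots x_m)^{-1}:(x_2\cdots x_m)^{-1}:\dots:x_m^{-1}:1\big),$$ where $\mathrm{I}_{n_1,\dots,n_m}(a_1:\dots:a_m:1)$ is the iterated integral over the real segment $[0,1]$ of the sequence of forms $\frac{dt}{t-a_1},\underbrace{\tfrac{dt}{t},\dots,\tfrac{dt}{t}}_{n_1-1},\dots,\frac{dt}{t-a_m},\underbrace{\tfrac{dt}{t},\dots,\tfrac{dt}{t}}_{n_m-1}$ over $0\le t_1\le t_2\le\dots\le1$ (first form in the innermost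 variable $t_1$). For real $a>0$ and complex $x,y$: $\mathcal{L}^a_r(x):=\mathrm{Li}_r(xa)-\mathrm{Li}_r(-xa)$. Writing $S_{r,s}(b;x,y):=\mathrm{Li}_{r,s}(bx,y/b)-\mathrm{Li}_{r,s}(-bx,y/b)+\mathrm{Li}_{r,s}(bx,-y/b)-\mathrm{Li}_{r,s}(-bx,-y/b)$, put $\mathcal{L}^a_{r,s}(x,y):=S_{r,s}(a;x,y)+S_{r,s}(1/a;x,y)$. Here $i$ is the imaginary unit. *)

theory Defs
  imports "HOL-Analysis.Analysis"
begin

(* A polynomial in n variables over the complex numbers is represented by its polynomial function;
   only the coordinates 0, ..., n - 1 of the argument are meaningful.  The torus is parametrised by
   x_j = exp (i theta_j), so that dx_j / (2 pi i x_j) becomes d theta_j / (2 pi).  The value of the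
   integrand at zeros of P (where ln 0 = 0 in HOL) is irrelevant: for a nonzero polynomial they
   form a null set. *)
definition mahler_measure :: "nat \<Rightarrow> ((nat \<Rightarrow> complex) \<Rightarrow> complex) \<Rightarrow> real" where
  "mahler_measure n P =
     1 / (2 * pi) ^ n *
     (LINT \<theta> : (\<Pi>\<^sub>E j\<in>{..<n}. {0..2*pi}) | (\<Pi>\<^sub>M j\<in>{..<n}. lborel).
        ln (norm (P (\<lambda>j. cis (\<theta> j)))))"

(* Iterated integral over 0 <= t_1 <= ... <= t_N <= u.  The head of the list is the form in the
   outermost variable t_N, so the list is in reverse order of the usual notation. *)
primrec iterated_integral_rev :: "(real \<Rightarrow> complex) list \<Rightarrow> real \<Rightarrow> complex" where
  "iterated_integral_rev [] u = 1"
| "iterated_integral_rev (f # fs) u = (LBINT t:{0..u}. f t * iterated_integral_rev fs t)"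

definition iterated_integral :: "(real \<Rightarrow> complex) list \<Rightarrow> complex" where
  "iterated_integral fs = iterated_integral_rev (rev fs) 1"

definition hyperlog_forms :: "nat \<Rightarrow> complex \<Rightarrow> (real \<Rightarrow> complex) list" where
  "hyperlog_forms n a =
     (\<lambda>t. 1 / (of_real t - a)) # replicate (n - 1) (\<lambda>t. 1 / of_real t)"

(* I_{n_1,...,n_m}(a_1 : ... : a_m : 1) *)
definition hyperlog :: "nat list \<Rightarrow> complex list \<Rightarrow> complex" where
  "hyperlog ns as = iterated_integral (concat (map2 hyperlog_forms ns as))"

(* The defining series on the open unit polydisc, and its continuation by iterated integrals
   along the real segment [0,1] everywhere else; both lists have the same length. *)
definition multi_polylog :: "nat list \<Rightarrow> complex list \<Rightarrow> complex" where
  "multi_polylog ns xs =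
     (if \<forall>x\<in>set xs. norm x < 1
      then \<Sum>\<^sub>\<infinity>ks\<in>{ks :: nat list. length ks = length ns \<and> sorted_wrt (<) ks \<and> (\<forall>k\<in>set ks. 0 < k)}.
             \<Prod>j<length ns. (xs ! j) ^ (ks ! j) / of_nat (ks ! j) ^ (ns ! j)
      else (-1) ^ length ns *
             hyperlog ns (map (\<lambda>j. inverse (prod_list (drop j xs))) [0..<length xs]))"

definition polylog_diff :: "real \<Rightarrow> nat \<Rightarrow> complex \<Rightarrow> complex" where
  "polylog_diff a r x =
     multi_polylog [r] [x * of_real a] - multi_polylog [r] [- x * of_real a]"

definition polylog_S :: "nat \<Rightarrow> nat \<Rightarrow> real \<Rightarrow> complex \<Rightarrow> complex \<Rightarrow> complex" where
  "polylog_S r s b x y =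
     multi_polylog [r, s] [of_real b * x, y / of_real b]
     - multi_polylog [r, s] [- of_real b * x, y / of_real b]
     + multi_polylog [r, s] [of_real b * x, - y / of_real b]
     - multi_polylog [r, s] [- of_real b * x, - y / of_real b]"

definition polylog_diff2 :: "real \<Rightarrow> nat \<Rightarrow> nat \<Rightarrow> complex \<Rightarrow> complex \<Rightarrow> complex" where
  "polylog_diff2 a r s x y = polylog_S r s a x y + polylog_S r s (1 / a) x y"

end

theory Submission
  imports Defs
begin

text \<open>Let \<open>P = (1 + w) (1 + x) + a (1 - w) (y + z)\<close>.  Rotating \<open>z\<close> by \<open>y\<close> turns \<open>y + z\<close> into
  \<open>y (1 + z)\<close>, and Jensen's formula in \<open>y\<close> reduces the Mahler measure to the mean of
  \<open>ln (max (\<bar>1 + w\<bar> \<bar>1 + x\<bar>) (a \<bar>1 - w\<bar> \<bar>1 + z\<bar>))\<close> (\<open>jensen_linear\<close>, \<open>jensen_two_variables\<close>).  Only the moduli of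
  sine and cosine of half angles occur, so all variables may be taken in \<open>[0, \<pi>/2]\<close>.  As \<open>ln \<bar>1 + w\<bar>\<close> and
  \<open>ln \<bar>1 + x\<bar>\<close> have mean zero, there remains the integral of
  \<open>ln\<^sup>+ (a tan w cos z / cos x)\<close> over the cube (\<open>nn_integral_max_quarter\<close>).

  The integral over \<open>x\<close> and \<open>z\<close> alone is a function \<open>K (a tan w)\<close>.  Writing \<open>ln\<^sup>+ (c / p)\<close> as the integral of
  \<open>ds / s\<close> over \<open>p < s < c\<close> and exchanging integrals, one meets the measure \<open>arcsin (s cos z)\<close> of
  \<open>{x. cos x < s cos z}\<close>, whose integral over \<open>z\<close> is \<open>\<chi>\<^sub>2(s)\<close>, where \<open>\<chi>\<^sub>p(s)\<close> is the sum of \<open>s\<^sup>n / n\<^sup>p\<close> over odd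
  \<open>n\<close>.  Hence \<open>K c = \<chi>\<^sub>3(c)\<close> for \<open>c \<le> 1\<close> (\<open>log_ratio_mean_le_1\<close>), and by symmetry
  \<open>K c = \<pi>\<^sup>2 / 4 ln c + \<chi>\<^sub>3(1 / c)\<close> for \<open>c \<ge> 1\<close> (\<open>log_ratio_mean_ge_1\<close>).  Substituting \<open>s = a tan w\<close> and
  \<open>s = 1 / (a tan w)\<close> on the two ranges of \<open>w\<close> gives three integrals over \<open>[0, 1]\<close>: those of
  \<open>\<chi>\<^sub>3(s) a / (a\<^sup>2 + s\<^sup>2)\<close>, of \<open>\<chi>\<^sub>3(s) a / (1 + a\<^sup>2 s\<^sup>2)\<close> and, from the term \<open>ln c\<close>, of \<open>arctan (a s) / s\<close> with the
  factor \<open>\<pi>\<^sup>2 / 4\<close> (\<open>mahler_measure_eq_integrals\<close>).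

  On the other side the iterated integrals are evaluated from the inside.  The difference of dilogarithms at
  \<open>\<plusminus> \<i> a\<close> is \<open>2 \<i>\<close> times the arctangent integral (\<open>polylog_diff_2\<close>).  In the four terms of \<open>S\<^sub>3\<^sub>,\<^sub>1(b; \<i>, \<i>)\<close> the inner layers
  combine to \<open>\<chi>\<^sub>3(t)\<close> and the outer forms to a multiple of \<open>b / (b\<^sup>2 + t\<^sup>2)\<close> (\<open>polylog_S_31\<close>); the values
  \<open>b = a\<close> and \<open>b = 1 / a\<close> produce the two integrals of \<open>\<chi>\<^sub>3\<close>.

  All real integrals are treated as integrals of nonnegative functions with values in the extended nonnegative reals,
  with \<open>C - ln \<bar>P\<bar>\<close> in place of \<open>ln \<bar>P\<bar>\<close>.  This lets the order of integration be changed freely, and integrability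
  comes out of the computation.\<close>

section \<open>Lebesgue measure on a segment and periodic functions\<close>

text \<open>Lebesgue measure on an interval, kept as a measure on the whole line so that its Borel sets
  are those of the line and functions need not be restricted.\<close>
definition seg :: "real \<Rightarrow> real \<Rightarrow> real measure" where
  "seg a b = density lborel (indicator {a..b})"

abbreviation (input) quarter :: "real measure" where "quarter \<equiv> seg 0 (pi / 2)"
abbreviation (input) circle :: "real measure" where "circle \<equiv> seg 0 (2 * pi)"

lemma sets_seg [simp, measurable_cong]: "sets (seg a b) = sets borel"
  by (simp add: seg_def)

lemma space_seg [simp]: "space (seg a b) = UNIV"
  by (simp add: seg_def)

lemma nn_integral_seg:
  assumes [measurable]: "f \<in> borel_measurable borel"
  shows "(\<integral>\<^sup>+x. f x \<partial>seg a b) = (\<integral>\<^sup>+x. f x * indicator {a..b} x \<partial>lborel)"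
  by (simp add: seg_def nn_integral_density mult.commute)

lemma emeasure_seg:
  assumes [measurable]: "A \<in> sets borel"
  shows "emeasure (seg a b) A = emeasure lborel (A \<inter> {a..b})"
  by (simp add: seg_def emeasure_density nn_integral_set_ennreal Int_commute flip: indicator_inter_arith)

lemma finite_measure_seg: "finite_measure (seg a b)"
  by (rule finite_measureI) (simp add: emeasure_seg emeasure_lborel_Icc_eq)

lemma emeasure_seg_UNIV: "a \<le> b \<Longrightarrow> emeasure (seg a b) UNIV = ennreal (b - a)"
  by (simp add: emeasure_seg)

interpretation seg: finite_measure "seg a b" for a b
  by (rule finite_measure_seg)

interpretation seg_pair: pair_sigma_finite "seg a b" "seg c d" for a b c d ..

lemma AE_seg:
  assumes "countable N" "\<And>x. a \<le> x \<Longrightarrow> x \<le> b \<Longrightarrow> x \<notin> N \<Longrightarrow> P x"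
  shows "AE x in seg a b. P x"
proof -
  have "AE x in lborel. x \<notin> N"
    using assms(1) by (rule AE_not_in[OF countable_imp_null_set_lborel])
  then show ?thesis
    unfolding seg_def by (subst AE_density) (auto elim!: eventually_mono simp: indicator_def assms(2))
qed

lemma nn_integral_seg_cong:
  assumes "\<And>x. a \<le> x \<Longrightarrow> x \<le> b \<Longrightarrow> f x = g x"
  shows "(\<integral>\<^sup>+x. f x \<partial>seg a b) = (\<integral>\<^sup>+x. g x \<partial>seg a b)"
  by (intro nn_integral_cong_AE AE_seg[of "{}"]) (auto simp: assms)

lemma nn_integral_seg_split:
  assumes [measurable]: "f \<in> borel_measurable borel" and "a \<le> b" "b \<le> c"
  shows "(\<integral>\<^sup>+x. f x \<partial>seg a c) = (\<integral>\<^sup>+x. f x \<partial>seg a b) + (\<integral>\<^sup>+x. f x \<partial>seg b c)"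
proof -
  have "(\<integral>\<^sup>+x. f x \<partial>seg a c) = (\<integral>\<^sup>+x. f x * indicator {a..b} x + f x * indicator {b..c} x \<partial>lborel)"
    unfolding nn_integral_seg[OF assms(1)]
    by (intro nn_integral_cong_AE eventually_mono[OF AE_lborel_singleton[of b]])
       (use assms in \<open>auto simp: indicator_def\<close>)
  also have "\<dots> = (\<integral>\<^sup>+x. f x \<partial>seg a b) + (\<integral>\<^sup>+x. f x \<partial>seg b c)"
    by (subst nn_integral_add) (auto simp: nn_integral_seg)
  finally show ?thesis .
qed

lemma nn_integral_seg_scale:
  assumes [measurable]: "f \<in> borel_measurable borel" and "c > 0"
  shows "(\<integral>\<^sup>+x. f x \<partial>seg (t + c * a) (t + c * b)) = c * (\<integral>\<^sup>+x. f (t + c * x) \<partial>seg a b)"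
proof -
  have *: "indicator {t + c * a..t + c * b} (t + c * x) = (indicator {a..b} x :: ennreal)" for x
    using \<open>c > 0\<close> by (auto simp: indicator_def)
  show ?thesis
    using \<open>c > 0\<close> nn_integral_real_affine[of "\<lambda>x. f x * indicator {t + c * a..t + c * b} x" c t]
    by (simp add: nn_integral_seg *)
qed

lemma nn_integral_seg_shift:
  assumes "f \<in> borel_measurable borel"
  shows "(\<integral>\<^sup>+x. f (x + t) \<partial>seg a b) = (\<integral>\<^sup>+x. f x \<partial>seg (a + t) (b + t))"
  using nn_integral_seg_scale[OF assms, of 1 t a b] by (simp add: add_ac)

lemma nn_integral_seg_reflect:
  assumes [measurable]: "f \<in> borel_measurable borel"
  shows "(\<integral>\<^sup>+x. f (t - x) \<partial>seg a b) = (\<integral>\<^sup>+x. f x \<partial>seg (t - b) (t - a))"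
proof -
  have *: "indicator {t - b..t - a} (t - x) = (indicator {a..b} x :: ennreal)" for x
    by (auto simp: indicator_def)
  show ?thesis
    using nn_integral_real_affine[of "\<lambda>x. f x * indicator {t - b..t - a} x" "-1" t]
    by (simp add: nn_integral_seg *)
qed

lemma nn_integral_seg_FTC:
  assumes "f \<in> borel_measurable borel"
    and "\<And>x. a \<le> x \<Longrightarrow> x \<le> b \<Longrightarrow> (F has_real_derivative f x) (at x)"
    and "\<And>x. a \<le> x \<Longrightarrow> x \<le> b \<Longrightarrow> 0 \<le> f x" and "a \<le> b"
  shows "(\<integral>\<^sup>+x. ennreal (f x) \<partial>seg a b) = ennreal (F b - F a)"
  unfolding nn_integral_seg[OF measurable_compose[OF assms(1) measurable_ennreal]]
proof (rule nn_integral_FTC_Icc)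
  fix x assume "x \<in> {a..b}"
  then show "(F has_real_derivative f x) (at x)" "0 \<le> f x"
    using assms(2,3)[of x] by auto
qed (use assms in auto)

lemma nn_integral_seg_substitution:
  assumes [measurable]: "f \<in> borel_measurable borel"
    and "\<And>x. a \<le> x \<Longrightarrow> x \<le> b \<Longrightarrow> (g has_real_derivative g' x) (at x)"
    and "continuous_on {a..b} g'" and "\<And>x. a \<le> x \<Longrightarrow> x \<le> b \<Longrightarrow> 0 \<le> g' x" and "a < b"
    and [measurable]: "g \<in> borel_measurable borel" "g' \<in> borel_measurable borel"
  shows "(\<integral>\<^sup>+x. f x \<partial>seg (g a) (g b)) = (\<integral>\<^sup>+x. f (g x) * ennreal (g' x) \<partial>seg a b)"
proof -
  have "(\<integral>\<^sup>+x. f x * indicator {g a..g b} x \<partial>lborel)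
          = (\<integral>\<^sup>+x. f (g x) * g' x * indicator {a..b} x \<partial>lborel)"
    by (rule nn_integral_substitution_aux) (use assms in auto)
  then show ?thesis
    by (simp add: nn_integral_seg)
qed

lemma nn_integral_circle_shift:
  fixes f :: "real \<Rightarrow> ennreal"
  assumes [measurable]: "f \<in> borel_measurable borel" and per: "\<And>x. f (x + 2 * pi) = f x"
    and s: "0 \<le> s" "s \<le> 2 * pi"
  shows "(\<integral>\<^sup>+x. f (x + s) \<partial>seg 0 (2 * pi)) = (\<integral>\<^sup>+x. f x \<partial>seg 0 (2 * pi))"
proof -
  have "(\<integral>\<^sup>+x. f (x + s) \<partial>seg 0 (2 * pi)) = (\<integral>\<^sup>+x. f x \<partial>seg s (s + 2 * pi))"
    by (subst nn_integral_seg_shift) (auto simp: add_ac)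
  also have "\<dots> = (\<integral>\<^sup>+x. f x \<partial>seg s (2 * pi)) + (\<integral>\<^sup>+x. f x \<partial>seg (2 * pi) (s + 2 * pi))"
    using s by (intro nn_integral_seg_split) auto
  also have "(\<integral>\<^sup>+x. f x \<partial>seg (2 * pi) (s + 2 * pi)) = (\<integral>\<^sup>+x. f x \<partial>seg 0 s)"
    using nn_integral_seg_shift[where f=f and t="2 * pi" and a=0 and b=s] by (simp add: per)
  also have "(\<integral>\<^sup>+x. f x \<partial>seg s (2 * pi)) + (\<integral>\<^sup>+x. f x \<partial>seg 0 s) = (\<integral>\<^sup>+x. f x \<partial>seg 0 (2 * pi))"
    using s by (subst (3) nn_integral_seg_split[of _ _ s]) (auto simp: add.commute)
  finally show ?thesis .
qed

lemma nn_integral_circle_double: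
  fixes f :: "real \<Rightarrow> ennreal"
  assumes [measurable]: "f \<in> borel_measurable borel" and per: "\<And>x. f (x + 2 * pi) = f x"
  shows "(\<integral>\<^sup>+x. f (2 * x) \<partial>seg 0 (2 * pi)) = (\<integral>\<^sup>+x. f x \<partial>seg 0 (2 * pi))"
proof -
  have "2 * (\<integral>\<^sup>+x. f (2 * x) \<partial>seg 0 (2 * pi)) = (\<integral>\<^sup>+x. f x \<partial>seg 0 (4 * pi))"
    using nn_integral_seg_scale[of f 2 0 0 "2 * pi"] by simp
  also have "\<dots> = (\<integral>\<^sup>+x. f x \<partial>seg 0 (2 * pi)) + (\<integral>\<^sup>+x. f x \<partial>seg (2 * pi) (4 * pi))"
    by (intro nn_integral_seg_split) auto
  also have "(\<integral>\<^sup>+x. f x \<partial>seg (2 * pi) (4 * pi)) = (\<integral>\<^sup>+x. f x \<partial>seg 0 (2 * pi))"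
    using nn_integral_seg_shift[OF assms(1), where a=0 and b="2 * pi" and t="2 * pi", symmetric] unfolding per by simp
  finally have "2 * (\<integral>\<^sup>+x. f (2 * x) \<partial>seg 0 (2 * pi)) = 2 * (\<integral>\<^sup>+x. f x \<partial>seg 0 (2 * pi))"
    by (simp only: mult_2)
  then show ?thesis
    by (simp add: ennreal_mult_cancel_left)
qed

text \<open>The half angle runs over \<open>[0, \<pi>]\<close>, which the symmetries of sine and cosine fold
  onto \<open>[0, \<pi>/2]\<close>; this is where all later integrals live.\<close>
lemma nn_integral_circle_quarter:
  fixes g :: "real \<Rightarrow> real \<Rightarrow> ennreal"
  assumes [measurable]: "(\<lambda>(c, s). g c s) \<in> borel_measurable (borel \<Otimes>\<^sub>M borel)"
  shows "(\<integral>\<^sup>+t. g \<bar>cos (t / 2)\<bar> \<bar>sin (t / 2)\<bar> \<partial>seg 0 (2 * pi))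
           = 4 * (\<integral>\<^sup>+t. g (cos t) (sin t) \<partial>seg 0 (pi / 2))"
proof -
  let ?f = "\<lambda>t. g \<bar>cos t\<bar> \<bar>sin t\<bar>"
  have "(\<integral>\<^sup>+t. ?f (t / 2) \<partial>seg 0 (2 * pi)) = 2 * (\<integral>\<^sup>+t. ?f t \<partial>seg 0 pi)"
    using nn_integral_seg_scale[of "\<lambda>t. ?f (t / 2)" 2 0 0 "pi"] by simp
  also have "(\<integral>\<^sup>+t. ?f t \<partial>seg 0 pi) = (\<integral>\<^sup>+t. ?f t \<partial>seg 0 (pi / 2)) + (\<integral>\<^sup>+t. ?f t \<partial>seg (pi / 2) pi)"
    by (intro nn_integral_seg_split) auto
  also have "(\<integral>\<^sup>+t. ?f t \<partial>seg (pi / 2) pi) = (\<integral>\<^sup>+t. ?f t \<partial>seg 0 (pi / 2))"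
    using nn_integral_seg_reflect[where f="?f" and t=pi and a=0 and b="pi / 2"] by simp
  also have "(\<integral>\<^sup>+t. ?f t \<partial>seg 0 (pi / 2)) = (\<integral>\<^sup>+t. g (cos t) (sin t) \<partial>seg 0 (pi / 2))"
    by (intro nn_integral_seg_cong) (auto simp: cos_ge_zero sin_ge_zero)
  finally show ?thesis
    by (simp flip: mult_2 mult.assoc)
qed

section \<open>Logarithmic integrals\<close>

text \<open>Since \<^const>\<open>ennreal\<close> sends negative reals to \<open>0\<close>, the right-hand side is the positive part
  \<open>ln\<^sup>+ (c / p)\<close>.  Written as an integral over \<open>s\<close>, a mean of \<open>ln\<^sup>+\<close> becomes by Tonelli an
  integral of measures of superlevel sets.\<close>
lemma nn_integral_inverse_above:
  assumes "0 < p" "0 < c"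
  shows "(\<integral>\<^sup>+s. ennreal (1 / s) * indicator {p<..} s \<partial>seg 0 c) = ennreal (ln (c / p))"
proof (cases "p \<le> c")
  case True
  have "(\<integral>\<^sup>+s. ennreal (1 / s) * indicator {p<..} s \<partial>seg 0 c)
        = (\<integral>\<^sup>+s. ennreal (1 / s) * indicator {p<..} s \<partial>seg 0 p)
          + (\<integral>\<^sup>+s. ennreal (1 / s) * indicator {p<..} s \<partial>seg p c)"
    using assms True by (intro nn_integral_seg_split) auto
  also have "(\<integral>\<^sup>+s. ennreal (1 / s) * indicator {p<..} s \<partial>seg 0 p) = (\<integral>\<^sup>+s. 0 \<partial>seg 0 p)"
    by (intro nn_integral_seg_cong) auto
  also have "(\<integral>\<^sup>+s. ennreal (1 / s) * indicator {p<..} s \<partial>seg p c) = (\<integral>\<^sup>+s. ennreal (1 / s) \<partial>seg p c)"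
    by (intro nn_integral_cong_AE AE_seg[of "{p}"]) auto
  also have "\<dots> = ennreal (ln c - ln p)"
    using assms True by (intro nn_integral_seg_FTC) (auto intro!: derivative_eq_intros)
  finally show ?thesis
    using assms by (simp add: ln_div)
next
  case False
  then have "(\<integral>\<^sup>+s. ennreal (1 / s) * indicator {p<..} s \<partial>seg 0 c) = (\<integral>\<^sup>+s. 0 \<partial>seg 0 c)"
    by (intro nn_integral_seg_cong) auto
  moreover have "ln (c / p) \<le> 0"
    using assms False by (simp add: ln_div)
  ultimately show ?thesis
    by (simp add: ennreal_neg)
qed

text \<open>Tonelli for \<open>- ln s = \<integral>\<^sub>s\<^sup>1 dr / r\<close>: integration by parts without boundary terms.\<close>
lemma nn_integral_minus_ln_weight:
  assumes [measurable]: "g \<in> borel_measurable borel"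
  shows "(\<integral>\<^sup>+s. ennreal (- ln s) * g s \<partial>seg 0 1) = (\<integral>\<^sup>+r. ennreal (1 / r) * (\<integral>\<^sup>+s. g s \<partial>seg 0 r) \<partial>seg 0 1)"
proof -
  have "(\<integral>\<^sup>+s. ennreal (- ln s) * g s \<partial>seg 0 1)
        = (\<integral>\<^sup>+s. (\<integral>\<^sup>+r. ennreal (1 / r) * indicator {s<..} r * g s \<partial>seg 0 1) \<partial>seg 0 1)"
  proof (intro nn_integral_cong_AE AE_seg[of "{0}"])
    fix s :: real assume "0 \<le> s" "s \<notin> {0}"
    then show "ennreal (- ln s) * g s = (\<integral>\<^sup>+r. ennreal (1 / r) * indicator {s<..} r * g s \<partial>seg 0 1)"
      using nn_integral_inverse_above[of s 1] by (simp add: nn_integral_multc ln_div)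
  qed simp
  also have "\<dots> = (\<integral>\<^sup>+r. (\<integral>\<^sup>+s. ennreal (1 / r) * indicator {s<..} r * g s \<partial>seg 0 1) \<partial>seg 0 1)"
    by (rule seg_pair.Fubini') (unfold indicator_def greaterThan_iff, measurable)
  also have "\<dots> = (\<integral>\<^sup>+r. ennreal (1 / r) * (\<integral>\<^sup>+s. g s \<partial>seg 0 r) \<partial>seg 0 1)"
  proof (intro nn_integral_seg_cong)
    fix r :: real assume r: "0 \<le> r" "r \<le> 1"
    have "(\<integral>\<^sup>+s. ennreal (1 / r) * indicator {s<..} r * g s \<partial>seg 0 1)
        = ennreal (1 / r) * (\<integral>\<^sup>+s. indicator {..<r} s * g s \<partial>seg 0 1)"
      by (subst nn_integral_cmult[symmetric]) (auto intro!: nn_integral_cong simp: indicator_def)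
    also have "(\<integral>\<^sup>+s. indicator {..<r} s * g s \<partial>seg 0 1) = (\<integral>\<^sup>+s. indicator {..<r} s * g s \<partial>seg 0 r)
       + (\<integral>\<^sup>+s. indicator {..<r} s * g s \<partial>seg r 1)"
      using r by (intro nn_integral_seg_split) auto
    also have "(\<integral>\<^sup>+s. indicator {..<r} s * g s \<partial>seg r 1) = (\<integral>\<^sup>+s. 0 \<partial>seg r 1)"
      by (intro nn_integral_seg_cong) auto
    also have "(\<integral>\<^sup>+s. indicator {..<r} s * g s \<partial>seg 0 r) = (\<integral>\<^sup>+s. g s \<partial>seg 0 r)"
      by (intro nn_integral_cong_AE AE_seg[of "{r}"]) auto
    finally show "(\<integral>\<^sup>+s. ennreal (1 / r) * indicator {s<..} r * g s \<partial>seg 0 1)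
        = ennreal (1 / r) * (\<integral>\<^sup>+s. g s \<partial>seg 0 r)" by simp
  qed
  finally show ?thesis .
qed

lemma nn_integral_minus_ln: "(\<integral>\<^sup>+s. ennreal (- ln s) \<partial>seg 0 1) = 1"
proof -
  have "(\<integral>\<^sup>+s. ennreal (- ln s) \<partial>seg 0 1) = (\<integral>\<^sup>+r. ennreal (1 / r) * (\<integral>\<^sup>+s. 1 \<partial>seg 0 r) \<partial>seg 0 1)"
    using nn_integral_minus_ln_weight[of "\<lambda>_. 1"] by simp
  also have "\<dots> = (\<integral>\<^sup>+r. 1 \<partial>seg 0 1)"
    by (intro nn_integral_cong_AE AE_seg[of "{0}"])
       (auto simp: emeasure_seg_UNIV simp flip: ennreal_mult')
  finally show ?thesis
    by (simp add: emeasure_seg_UNIV)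
qed

text \<open>The sine is concave on \<open>[0, \<pi>/2]\<close>, so it lies above its chord.\<close>
lemma sin_ge_chord:
  assumes "0 \<le> t" "t \<le> 1"
  shows "t \<le> sin (pi / 2 * t)"
proof -
  have "convex_on {0..pi / 2} (\<lambda>x. - sin x :: real)"
    by (rule f''_ge0_imp_convex[where f' = "\<lambda>x. - cos x" and f'' = sin])
       (auto intro!: derivative_eq_intros simp: sin_ge_zero)
  from convex_onD[OF this, of t 0 "pi / 2"] show ?thesis
    using assms by (simp add: mult.commute)
qed

lemma nn_integral_minus_ln_sin_quarter: "(\<integral>\<^sup>+t. ennreal (- ln (sin t)) \<partial>seg 0 (pi / 2)) < \<infinity>"
proof -
  have "(\<integral>\<^sup>+t. ennreal (- ln (sin t)) \<partial>seg 0 (pi / 2)) = ennreal (pi / 2) * (\<integral>\<^sup>+t. ennreal (- ln (sin (pi / 2 * t))) \<partial>seg 0 1)"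
    using nn_integral_seg_scale[of "\<lambda>t. ennreal (- ln (sin t))" "pi / 2" 0 0 1] by simp
  also have "\<dots> \<le> ennreal (pi / 2) * (\<integral>\<^sup>+t. ennreal (- ln t) \<partial>seg 0 1)"
  proof (intro mult_left_mono nn_integral_mono_AE AE_seg[of "{0}"] ennreal_leI)
    fix t :: real assume "0 \<le> t" "t \<le> 1" "t \<notin> {0}"
    then have "0 < t" "t \<le> sin (pi / 2 * t)"
      using sin_ge_chord by (auto simp del: times_divide_eq_left)
    then show "- ln (sin (pi / 2 * t)) \<le> - ln t"
      by simp
  qed auto
  also have "\<dots> < \<infinity>"
    by (simp add: nn_integral_minus_ln)
  finally show ?thesis .
qed

lemma nn_integral_minus_ln_cos_quarter: "(\<integral>\<^sup>+t. ennreal (- ln (cos t)) \<partial>seg 0 (pi / 2)) < \<infinity>"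
  using nn_integral_seg_reflect[where f="\<lambda>t. ennreal (- ln (sin t))" and t="pi / 2" and a=0 and b="pi / 2"]
    nn_integral_minus_ln_sin_quarter
  by (simp add: sin_diff)

text \<open>Finiteness is all that Jensen's formula needs: it gives a bound, uniform in the radius, for
  the logarithmic means below.\<close>
lemma nn_integral_minus_ln_sin_circle: "(\<integral>\<^sup>+t. ennreal (- ln \<bar>sin t\<bar>) \<partial>seg 0 (2 * pi)) < \<infinity>"
proof -
  have "(\<integral>\<^sup>+t. ennreal (- ln \<bar>sin t\<bar>) \<partial>seg 0 (2 * pi))
      \<le> (\<integral>\<^sup>+t. ennreal (- ln \<bar>cos (t / 2)\<bar>) + ennreal (- ln \<bar>sin (t / 2)\<bar>) \<partial>seg 0 (2 * pi))"
  proof (intro nn_integral_mono)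
    fix t :: real
    have *: "\<bar>sin t\<bar> = 2 * \<bar>cos (t / 2)\<bar> * \<bar>sin (t / 2)\<bar>"
      using sin_double[of "t / 2"] by (simp add: abs_mult)
    show "ennreal (- ln \<bar>sin t\<bar>) \<le> ennreal (- ln \<bar>cos (t / 2)\<bar>) + ennreal (- ln \<bar>sin (t / 2)\<bar>)"
    proof (cases "sin t = 0")
      case False
      then have "0 < \<bar>cos (t / 2)\<bar>" "0 < \<bar>sin (t / 2)\<bar>"
        using * by auto
      moreover from this have "ln \<bar>cos (t / 2)\<bar> \<le> 0" "ln \<bar>sin (t / 2)\<bar> \<le> 0"
        by (simp_all add: ln_le_zero_iff)
      moreover have "ln (2::real) \<ge> 0" by simp
      ultimately show ?thesis
        unfolding * by (simp add: ln_mult ennreal_leI flip: ennreal_plus)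
    qed simp
  qed
  also have "\<dots> = 4 * (\<integral>\<^sup>+t. ennreal (- ln (cos t)) + ennreal (- ln (sin t)) \<partial>seg 0 (pi / 2))"
    by (rule nn_integral_circle_quarter) measurable
  also have "\<dots> < \<infinity>"
    using nn_integral_minus_ln_cos_quarter nn_integral_minus_ln_sin_quarter
    by (simp add: nn_integral_add ennreal_mult_less_top)
  finally show ?thesis .
qed

section \<open>Jensen's formula for linear polynomials\<close>

text \<open>Multiplying by \<open>cis (- t)\<close> gives \<open>cis (- t) + r\<close>, whose imaginary part is \<open>- sin t\<close>.  The bound
  does not depend on \<open>r\<close>, so it also covers the boundary case \<open>r = 1\<close>.\<close>
lemma norm_one_plus_cis_ge: "\<bar>sin t\<bar> \<le> norm (1 + of_real r * cis t)"
proof -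
  have "sin t ^ 2 \<le> sin t ^ 2 + (r + cos t) ^ 2"
    by simp
  also have "\<dots> = (1 + r * cos t) ^ 2 + (r * sin t) ^ 2"
    using sin_cos_squared_add[of t] by algebra
  finally show ?thesis
    by (simp add: cmod_def real_le_rsqrt)
qed

lemma borel_measurable_cis [measurable]: "cis \<in> borel_measurable borel"
  by (intro borel_measurable_continuous_onI continuous_intros)

lemma countable_sin_zeros: "countable {t :: real. sin t = 0}"
  by (simp add: sin_zero_iff_int2 full_SetCompr_eq)

lemma ennreal_add_cong:
  "0 \<le> a \<Longrightarrow> 0 \<le> b \<Longrightarrow> 0 \<le> c \<Longrightarrow> 0 \<le> d \<Longrightarrow> a + b = c + d
    \<Longrightarrow> ennreal a + ennreal b = ennreal c + ennreal d"
  by (simp flip: ennreal_plus)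

lemma ennreal_add_left_cancel_real:
  "ennreal x + a = ennreal x + b \<longleftrightarrow> a = b"
  by (simp add: ennreal_add_left_cancel)

text \<open>The logarithmic mean of \<open>1 + r cis t\<close>, reflected at \<open>ln 2\<close> to make the integrand
  nonnegative for \<open>\<bar>r\<bar> \<le> 1\<close>.\<close>
definition jensen_defect :: "real \<Rightarrow> ennreal" where
  "jensen_defect r = (\<integral>\<^sup>+t. ennreal (ln 2 - ln (norm (1 + of_real r * cis t))) \<partial>seg 0 (2 * pi))"

lemma cis_pi_shift: "cis (t + pi) = - cis t" "cis (t + 2 * pi) = cis t"
  by (simp_all add: complex_eq_iff)

lemma jensen_defect_minus: "jensen_defect (- r) = jensen_defect r"
  unfolding jensen_defect_def
  using nn_integral_circle_shift[of "\<lambda>t. ennreal (ln 2 - ln (norm (1 + of_real r * cis t)))" pi]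
  by (simp add: cis_pi_shift)

text \<open>From \<open>(1 + r z) (1 - r z) = 1 - r\<^sup>2 z\<^sup>2\<close>: the logarithmic mean \<open>M\<close> satisfies
  \<open>M r + M (- r) = M (- r\<^sup>2)\<close>, because \<open>z \<mapsto> z\<^sup>2\<close> preserves the mean over the circle, and \<open>M\<close> is even by
  rotation through \<open>\<pi>\<close>.\<close>
lemma jensen_defect_double:
  assumes "\<bar>r\<bar> \<le> 1"
  shows "2 * jensen_defect r = ennreal (2 * pi * ln 2) + jensen_defect (r ^ 2)"
proof -
  let ?f = "\<lambda>r t. ennreal (ln 2 - ln (norm (1 + of_real r * cis t)))"
  have le2: "norm (1 + of_real r * cis t) \<le> 2" if "\<bar>r\<bar> \<le> 1" for r t
    using norm_triangle_ineq[of 1 "of_real r * cis t"] that by (simp add: norm_mult)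
  have "\<bar>r\<^sup>2\<bar> \<le> 1"
    using assms by (simp add: abs_square_le_1)
  have "2 * jensen_defect r = (\<integral>\<^sup>+t. ?f r t \<partial>seg 0 (2 * pi)) + (\<integral>\<^sup>+t. ?f (- r) t \<partial>seg 0 (2 * pi))"
    using jensen_defect_minus[of r] unfolding jensen_defect_def by (simp only: mult_2)
  also have "\<dots> = (\<integral>\<^sup>+t. ?f r t + ?f (- r) t \<partial>seg 0 (2 * pi))"
    by (intro nn_integral_add[symmetric]) auto
  also have "\<dots> = (\<integral>\<^sup>+t. ennreal (ln 2) + ?f (- (r ^ 2)) (2 * t) \<partial>seg 0 (2 * pi))"
  proof (intro nn_integral_cong_AE AE_seg[OF countable_sin_zeros])
    fix t :: real assume "t \<notin> {t. sin t = 0}"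
    then have "0 < \<bar>sin t\<bar>" by simp
    then have pos: "0 < norm (1 + of_real r * cis t)" "0 < norm (1 + of_real (- r) * cis t)"
      using norm_one_plus_cis_ge[of t] by (meson less_le_trans)+
    have le: "ln (norm (1 + of_real r * cis t)) \<le> ln 2" "ln (norm (1 + of_real (- r) * cis t)) \<le> ln 2"
      using pos le2[of r t] le2[of "- r" t] assms by (subst ln_le_cancel_iff; simp)+
    have eq: "(1 + of_real r * cis t) * (1 + of_real (- r) * cis t) = 1 + of_real (- (r ^ 2)) * cis (2 * t)"
      by (simp add: algebra_simps power2_eq_square cis_mult)
    have "ln (norm (1 + of_real (- (r ^ 2)) * cis (2 * t)))
        = ln (norm (1 + of_real r * cis t)) + ln (norm (1 + of_real (- r) * cis t))"
      unfolding eq[symmetric] norm_mult using pos by (intro ln_mult_pos) auto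
    moreover have "ln (norm (1 + of_real (- (r ^ 2)) * cis (2 * t))) \<le> ln 2"
      using pos le2[of "- (r ^ 2)" "2 * t"] \<open>\<bar>r\<^sup>2\<bar> \<le> 1\<close> eq
      by (subst ln_le_cancel_iff) (auto simp: norm_mult simp flip: eq)
    ultimately show "?f r t + ?f (- r) t = ennreal (ln 2) + ?f (- (r ^ 2)) (2 * t)"
      using le by (simp flip: ennreal_plus)
  qed
  also have "\<dots> = ennreal (2 * pi * ln 2) + (\<integral>\<^sup>+t. ?f (- (r ^ 2)) (2 * t) \<partial>seg 0 (2 * pi))"
    by (subst nn_integral_add) (auto simp: emeasure_seg_UNIV mult.commute simp flip: ennreal_mult)
  also have "(\<integral>\<^sup>+t. ?f (- (r ^ 2)) (2 * t) \<partial>seg 0 (2 * pi)) = jensen_defect (- (r ^ 2))"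
    unfolding jensen_defect_def by (intro nn_integral_circle_double) (auto simp: cis_pi_shift)
  finally show ?thesis
    by (simp only: jensen_defect_minus)
qed

lemma jensen_defect_bounded: "\<exists>K. \<forall>r. \<bar>r\<bar> \<le> 1 \<longrightarrow> jensen_defect r \<le> ennreal K"
proof -
  let ?K = "\<integral>\<^sup>+t. ennreal (ln 2) + ennreal (- ln \<bar>sin t\<bar>) \<partial>seg 0 (2 * pi)"
  have "?K < \<infinity>"
    using nn_integral_minus_ln_sin_circle
    by (subst nn_integral_add) (auto simp: emeasure_seg_UNIV simp flip: ennreal_mult)
  moreover have "jensen_defect r \<le> ?K" for r
    unfolding jensen_defect_def
  proof (intro nn_integral_mono_AE AE_seg[OF countable_sin_zeros])
    fix t :: real assume "t \<notin> {t. sin t = 0}"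
    then have "0 < \<bar>sin t\<bar>" by simp
    moreover have "ln \<bar>sin t\<bar> \<le> 0"
      using \<open>0 < \<bar>sin t\<bar>\<close> by (simp add: ln_le_zero_iff)
    moreover have "ln \<bar>sin t\<bar> \<le> ln (norm (1 + of_real r * cis t))"
      using \<open>0 < \<bar>sin t\<bar>\<close> norm_one_plus_cis_ge[of t r] by (subst ln_le_cancel_iff) auto
    ultimately show "ennreal (ln 2 - ln (norm (1 + of_real r * cis t))) \<le> ennreal (ln 2) + ennreal (- ln \<bar>sin t\<bar>)"
      by (auto intro!: ennreal_leI simp flip: ennreal_plus)
  qed
  ultimately show ?thesis
    by (intro exI[of _ "enn2real ?K"]) auto
qed

text \<open>A bounded function on \<open>[-1, 1]\<close> with \<open>2 \<delta> r = \<delta> (r\<^sup>2)\<close> vanishes, since \<open>2\<^sup>n \<delta> r\<close> stays bounded.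
  This settles the boundary case \<open>r = 1\<close> together with \<open>r < 1\<close>.\<close>
lemma jensen_defect_eq:
  assumes "\<bar>r\<bar> \<le> 1"
  shows "jensen_defect r = ennreal (2 * pi * ln 2)"
proof -
  obtain K where K: "\<And>r. \<bar>r\<bar> \<le> 1 \<Longrightarrow> jensen_defect r \<le> ennreal K"
    using jensen_defect_bounded by blast
  define \<delta> where "\<delta> r = enn2real (jensen_defect r) - 2 * pi * ln 2" for r
  have fin: "jensen_defect r = ennreal (enn2real (jensen_defect r))" if "\<bar>r\<bar> \<le> 1" for r
    using K[OF that] by (metis ennreal_enn2real_if ennreal_neq_top neq_top_trans)
  have double: "2 * \<delta> r = \<delta> (r ^ 2)" if r: "\<bar>r\<bar> \<le> 1" for r
  proof -
    have "\<bar>r\<^sup>2\<bar> \<le> 1"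
      using r by (simp add: abs_square_le_1)
    have "ennreal (2 * enn2real (jensen_defect r)) = ennreal (2 * pi * ln 2 + enn2real (jensen_defect (r ^ 2)))"
      using jensen_defect_double[OF r] fin[OF r] fin[OF \<open>\<bar>r\<^sup>2\<bar> \<le> 1\<close>]
      by (simp add: ennreal_mult ennreal_plus)
    then show ?thesis
      by (subst (asm) ennreal_inj) (auto simp: \<delta>_def)
  qed
  have bound: "2 ^ n * \<bar>\<delta> r\<bar> \<le> \<bar>K\<bar> + 2 * pi * ln 2" if "\<bar>r\<bar> \<le> 1" for r n
    using that
  proof (induction n arbitrary: r)
    case 0
    have "enn2real (jensen_defect r) \<le> \<bar>K\<bar>"
      using K[OF 0] by (intro enn2real_leI) (auto intro: order_trans ennreal_leI)
    moreover have "0 \<le> enn2real (jensen_defect r)" "0 \<le> 2 * pi * ln 2"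
      by simp_all
    ultimately show ?case
      unfolding \<delta>_def power_0 mult_1 by linarith
  next
    case (Suc n)
    have "\<bar>r\<^sup>2\<bar> \<le> 1"
      using Suc.prems by (simp add: abs_square_le_1)
    from Suc.IH[OF this] double[OF Suc.prems, symmetric] show ?case
      by (simp add: abs_mult)
  qed
  have "\<delta> r = 0"
  proof (rule ccontr)
    assume "\<delta> r \<noteq> 0"
    then obtain n where "(\<bar>K\<bar> + 2 * pi * ln 2) / \<bar>\<delta> r\<bar> < 2 ^ n"
      using real_arch_pow[of 2] by auto
    with bound[OF assms, of n] \<open>\<delta> r \<noteq> 0\<close> show False
      by (simp add: field_simps)
  qed
  then show ?thesis
    using fin[OF assms] by (simp add: \<delta>_def)
qed

lemma jensen_real:
  assumes r: "\<bar>r\<bar> \<le> 1" and A: "0 < A" and C: "ln (A * (1 + \<bar>r\<bar>)) \<le> C"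
  shows "(\<integral>\<^sup>+t. ennreal (C - ln (A * norm (1 + of_real r * cis t))) \<partial>seg 0 (2 * pi)) = ennreal (2 * pi * (C - ln A))"
proof -
  have "ln A + ln (1 + \<bar>r\<bar>) \<le> C"
    using A C by (subst (asm) ln_mult_pos) auto
  moreover have "0 \<le> ln (1 + \<bar>r\<bar>)" "ln (1 + \<bar>r\<bar>) \<le> ln 2"
    using r by simp_all
  ultimately have C': "0 \<le> C - ln A"
    by linarith
  have "ennreal (2 * pi * ln 2) + (\<integral>\<^sup>+t. ennreal (C - ln (A * norm (1 + of_real r * cis t))) \<partial>seg 0 (2 * pi))
      = (\<integral>\<^sup>+t. ennreal (ln 2) + ennreal (C - ln (A * norm (1 + of_real r * cis t))) \<partial>seg 0 (2 * pi))"
    by (subst nn_integral_add) (auto simp: emeasure_seg_UNIV mult.commute simp flip: ennreal_mult)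
  also have "\<dots> = (\<integral>\<^sup>+t. ennreal (C - ln A) + ennreal (ln 2 - ln (norm (1 + of_real r * cis t))) \<partial>seg 0 (2 * pi))"
  proof (intro nn_integral_cong_AE AE_seg[OF countable_sin_zeros])
    fix t :: real assume "t \<notin> {t. sin t = 0}"
    then have "0 < \<bar>sin t\<bar>" by simp
    then have pos: "0 < norm (1 + of_real r * cis t)"
      using norm_one_plus_cis_ge[of t] by (meson less_le_trans)
    have "norm (1 + of_real r * cis t) \<le> 1 + \<bar>r\<bar>"
      using norm_triangle_ineq[of 1 "of_real r * cis t"] by (simp add: norm_mult)
    then have "ln (norm (1 + of_real r * cis t)) \<le> ln (1 + \<bar>r\<bar>)"
      using pos by (subst ln_le_cancel_iff) auto
    moreover have "ln (A * norm (1 + of_real r * cis t)) = ln A + ln (norm (1 + of_real r * cis t))"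
      using A pos by (intro ln_mult_pos) auto
    ultimately show "ennreal (ln 2) + ennreal (C - ln (A * norm (1 + of_real r * cis t)))
      = ennreal (C - ln A) + ennreal (ln 2 - ln (norm (1 + of_real r * cis t)))"
      using C' \<open>ln A + ln (1 + \<bar>r\<bar>) \<le> C\<close> \<open>ln (1 + \<bar>r\<bar>) \<le> ln 2\<close> \<open>0 \<le> ln (1 + \<bar>r\<bar>)\<close>
      by (intro ennreal_add_cong) linarith+
  qed
  also have "\<dots> = ennreal (2 * pi * (C - ln A)) + ennreal (2 * pi * ln 2)"
    using C' jensen_defect_eq[OF r]
    by (subst nn_integral_add) (auto simp: emeasure_seg_UNIV mult.commute jensen_defect_def simp flip: ennreal_mult)
  finally show ?thesis
    by (simp add: add.commute[of _ "ennreal (2 * pi * ln 2)"] ennreal_add_left_cancel_real)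
qed

lemma jensen_linear_aux:
  assumes AB: "norm B \<le> norm A" and "A \<noteq> 0" and C: "ln (norm A + norm B) \<le> C"
  shows "(\<integral>\<^sup>+t. ennreal (C - ln (norm (A + B * cis t))) \<partial>seg 0 (2 * pi)) = ennreal (2 * pi * (C - ln (norm A)))"
proof -
  define \<rho> where "\<rho> = B / A"
  define r where "r = norm \<rho>"
  define \<phi> where "\<phi> = Arg2pi \<rho>"
  have \<phi>: "0 \<le> \<phi>" "\<phi> \<le> 2 * pi" and \<rho>: "\<rho> = of_real r * cis \<phi>"
    using Arg2pi[of \<rho>] by (auto simp: \<phi>_def r_def is_Arg_def cis_conv_exp)
  have r: "\<bar>r\<bar> \<le> 1"
    using assms by (simp add: r_def \<rho>_def norm_divide divide_le_eq_1)
  have rA: "norm A * (1 + \<bar>r\<bar>) = norm A + norm B"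
    using \<open>A \<noteq> 0\<close> by (simp add: r_def \<rho>_def norm_divide field_simps)
  have eq: "norm (A + B * cis t) = norm A * norm (1 + of_real r * cis (t + \<phi>))" for t
  proof -
    have "A + B * cis t = A * (1 + \<rho> * cis t)"
      using \<open>A \<noteq> 0\<close> by (simp add: \<rho>_def field_simps)
    then show ?thesis
      by (simp add: \<rho> norm_mult cis_mult[symmetric] mult_ac)
  qed
  have "(\<integral>\<^sup>+t. ennreal (C - ln (norm (A + B * cis t))) \<partial>seg 0 (2 * pi))
     = (\<integral>\<^sup>+t. ennreal (C - ln (norm A * norm (1 + of_real r * cis t))) \<partial>seg 0 (2 * pi))"
    unfolding eq using \<phi>
    by (intro nn_integral_circle_shift[of "\<lambda>t. ennreal (C - ln (norm A * norm (1 + of_real r * cis t)))"])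
       (auto simp: cis_pi_shift)
  also have "\<dots> = ennreal (2 * pi * (C - ln (norm A)))"
    using \<open>A \<noteq> 0\<close> r C rA by (intro jensen_real) auto
  finally show ?thesis .
qed

text \<open>Jensen's formula.  The statement holds even for \<open>A = B = 0\<close>, thanks to \<open>ln 0 = 0\<close>.  If
  \<open>\<bar>A\<bar> < \<bar>B\<bar>\<close>, conjugation exchanges the roles of the two coefficients.\<close>
lemma jensen_linear:
  assumes C: "ln (norm A + norm B) \<le> C"
  shows "(\<integral>\<^sup>+t. ennreal (C - ln (norm (A + B * cis t))) \<partial>seg 0 (2 * pi))
           = ennreal (2 * pi * (C - ln (max (norm A) (norm B))))"
proof (cases "norm B \<le> norm A")
  case True
  show ?thesis
  proof (cases "A = 0")
    case True
    then have "B = 0" using \<open>norm B \<le> norm A\<close> by simp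
    with True C show ?thesis
      by (simp add: emeasure_seg_UNIV mult.commute flip: ennreal_mult)
  next
    case False
    then show ?thesis
      using jensen_linear_aux[OF True False C] True by (simp add: max_def)
  qed
next
  case False
  have "norm (A + B * cis t) = norm (cnj B + cnj A * cis t)" for t
  proof -
    have "A + B * cis t = cis t * cnj (cnj B + cnj A * cis t)"
      by (simp add: algebra_simps cis_cnj cis_mult)
    then show ?thesis
      by (simp add: norm_mult del: complex_cnj_add)
  qed
  then show ?thesis
    using False jensen_linear_aux[of "cnj A" "cnj B" C] C
    by (cases "B = 0") (auto simp: max_def add.commute)
qed

section \<open>The mean of the positive logarithm of a ratio of cosines\<close>

text \<open>Legendre's chi function \<open>\<Sum> t\<^sup>n / n\<^sup>p\<close> over odd \<open>n\<close>, that is \<open>(Li\<^sub>p t - Li\<^sub>p (- t)) / 2\<close>.  Summing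
  over all \<open>n\<close> with a parity factor avoids reindexing when it is compared with the polylogarithm.\<close>
definition legendre_chi :: "nat \<Rightarrow> real \<Rightarrow> real" where
  "legendre_chi p t = (\<Sum>n. of_bool (odd n) * t ^ n / real n ^ p)"

lemma summable_inverse_powers: "2 \<le> p \<Longrightarrow> summable (\<lambda>n. 1 / real n ^ p)"
  using inverse_power_summable[of p, where ?'a=real] by (simp add: divide_inverse)

lemma summable_chi:
  assumes "\<bar>t\<bar> \<le> 1" "1 \<le> p" "\<bar>t\<bar> < 1 \<or> 2 \<le> p"
  shows "summable (\<lambda>n. of_bool (odd n) * t ^ n / real n ^ p)"
proof (cases "2 \<le> p")
  case True
  show ?thesis
    by (rule summable_comparison_test'[OF summable_inverse_powers[OF True], of 0])
       (auto simp: power_abs intro!: divide_right_mono power_le_one assms)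
next
  case False
  then have "\<bar>t\<bar> < 1" using assms by simp
  have "\<bar>t\<bar> ^ n / real n ^ p \<le> \<bar>t\<bar> ^ n" for n
    using assms(2) mult_left_mono[of 1 "real n ^ p" "\<bar>t\<bar> ^ n"]
    by (cases "n = 0") (auto simp: divide_le_eq one_le_power power_0_left)
  then show ?thesis
    by (intro summable_comparison_test'[OF summable_geometric[of "\<bar>t\<bar>"], of 0])
       (use \<open>\<bar>t\<bar> < 1\<close> in \<open>auto simp: power_abs\<close>)
qed

lemma chi_nonneg: "0 \<le> t \<Longrightarrow> t \<le> 1 \<Longrightarrow> 2 \<le> p \<Longrightarrow> 0 \<le> legendre_chi p t"
  unfolding legendre_chi_def by (intro suminf_nonneg summable_chi) auto

lemma borel_measurable_chi [measurable]: "legendre_chi p \<in> borel_measurable borel"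
  unfolding legendre_chi_def[abs_def] by measurable

lemma chi_1:
  assumes "\<bar>r\<bar> < 1"
  shows "legendre_chi 1 r = artanh r"
proof -
  have "(\<lambda>n. (- ((- r) ^ n) / real n - - ((- (- r)) ^ n) / real n) / 2) sums ((ln (1 + r) - ln (1 + - r)) / 2)"
    using assms by (intro sums_divide sums_diff ln_series') auto
  moreover have "(- ((- r) ^ n) / real n - - ((- (- r)) ^ n) / real n) / 2 = of_bool (odd n) * r ^ n / real n ^ 1" for n
    by (cases "even n") auto
  ultimately have "(\<lambda>n. of_bool (odd n) * r ^ n / real n ^ 1) sums ((ln (1 + r) - ln (1 + - r)) / 2)"
    by simp
  moreover have "(ln (1 + r) - ln (1 + - r)) / 2 = artanh r"
    using assms by (simp add: artanh_def ln_divide_pos)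
  ultimately show ?thesis
    unfolding legendre_chi_def by (simp add: sums_unique[symmetric])
qed

text \<open>The recursion \<open>\<chi>\<^sub>p\<^sub>+\<^sub>1(s) = \<integral>\<^sub>0\<^sup>s \<chi>\<^sub>p(r) dr / r\<close>, by termwise integration of nonnegative terms.\<close>
lemma nn_integral_chi:
  assumes "1 \<le> p" "0 \<le> s" "s \<le> 1"
  shows "(\<integral>\<^sup>+r. ennreal (legendre_chi p r / r) \<partial>seg 0 s) = ennreal (legendre_chi (p + 1) s)"
proof -
  have "(\<integral>\<^sup>+r. ennreal (legendre_chi p r / r) \<partial>seg 0 s)
      = (\<integral>\<^sup>+r. (\<Sum>n. ennreal (of_bool (odd n) / real n ^ p * r ^ (n - 1))) \<partial>seg 0 s)"
  proof (intro nn_integral_cong_AE AE_seg[of "{0, 1}"])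
    fix r assume r: "0 \<le> r" "r \<le> s" "r \<notin> {0, 1}"
    then have "0 < r" "r < 1" using assms by auto
    have eq: "of_bool (odd n) * r ^ n / real n ^ p / r = of_bool (odd n) / real n ^ p * r ^ (n - 1)" for n
      using \<open>0 < r\<close> by (cases n) auto
    have sm: "summable (\<lambda>n. of_bool (odd n) * r ^ n / real n ^ p)"
      using \<open>0 < r\<close> \<open>r < 1\<close> assms by (intro summable_chi) auto
    have "legendre_chi p r / r = (\<Sum>n. of_bool (odd n) / real n ^ p * r ^ (n - 1))"
      using suminf_divide[OF sm, of r] by (simp only: legendre_chi_def eq)
    moreover have "summable (\<lambda>n. of_bool (odd n) / real n ^ p * r ^ (n - 1))"
      using summable_divide[OF sm, of r] by (simp only: eq)
    ultimately show "ennreal (legendre_chi p r / r) = (\<Sum>n. ennreal (of_bool (odd n) / real n ^ p * r ^ (n - 1)))"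
      using \<open>0 < r\<close> by (subst suminf_ennreal2) auto
  qed simp
  also have "\<dots> = (\<Sum>n. \<integral>\<^sup>+r. ennreal (of_bool (odd n) / real n ^ p * r ^ (n - 1)) \<partial>seg 0 s)"
    by (intro nn_integral_suminf) simp
  also have "\<dots> = (\<Sum>n. ennreal (of_bool (odd n) * s ^ n / real n ^ (p + 1)))"
  proof (intro arg_cong[where f = suminf] ext)
    fix n :: nat
    show "(\<integral>\<^sup>+r. ennreal (of_bool (odd n) / real n ^ p * r ^ (n - 1)) \<partial>seg 0 s)
          = ennreal (of_bool (odd n) * s ^ n / real n ^ (p + 1))"
    proof (cases "odd n")
      case True
      then have "0 < n" by (auto intro: Nat.gr0I)
      have "(\<integral>\<^sup>+r. ennreal (of_bool (odd n) / real n ^ p * r ^ (n - 1)) \<partial>seg 0 s)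
          = ennreal (of_bool (odd n) * s ^ n / real n ^ (p + 1) - of_bool (odd n) * 0 ^ n / real n ^ (p + 1))"
        using \<open>0 \<le> s\<close> \<open>0 < n\<close>
        by (intro nn_integral_seg_FTC) (auto intro!: derivative_eq_intros)
      then show ?thesis using \<open>0 < n\<close> True by (simp add: power_0_left)
    qed simp
  qed
  also have "\<dots> = ennreal (legendre_chi (p + 1) s)"
    unfolding legendre_chi_def using assms by (intro suminf_ennreal2 summable_chi) auto
  finally show ?thesis .
qed

lemma emeasure_cos_less:
  assumes "0 \<le> k" "k \<le> 1"
  shows "emeasure (seg 0 (pi / 2)) {t. cos t < k} = ennreal (arcsin k)"
proof -
  have b: "0 \<le> arccos k" "arccos k \<le> pi / 2"
    using assms arcsin_bounded[of k] arcsin_le_arcsin[of 0 k] arccos_lbound[of k] by (auto simp: arccos_arcsin_eq)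
  have "{t. cos t < k} \<inter> {0..pi / 2} = {arccos k<..pi / 2}"
  proof (intro equalityI subsetI)
    fix t assume "t \<in> {t. cos t < k} \<inter> {0..pi / 2}"
    then have t: "cos t < cos (arccos k)" "0 \<le> t" "t \<le> pi / 2"
      using assms by auto
    then show "t \<in> {arccos k<..pi / 2}"
      using b cos_mono_less_eq[of t "arccos k"] by auto
  next
    fix t assume t: "t \<in> {arccos k<..pi / 2}"
    then have "cos t < cos (arccos k)"
      using b by (intro cos_monotone_0_pi) auto
    then show "t \<in> {t. cos t < k} \<inter> {0..pi / 2}"
      using t b assms by auto
  qed
  then show ?thesis
    using b assms by (simp add: emeasure_seg arccos_arcsin_eq)
qed

lemma nn_integral_arcsin_derivative:
  assumes "0 \<le> s" "0 \<le> m" "s * m < 1"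
  shows "(\<integral>\<^sup>+r. ennreal (m / sqrt (1 - (r * m) ^ 2)) \<partial>seg 0 s) = ennreal (arcsin (s * m))"
proof -
  have "(\<integral>\<^sup>+r. ennreal (m / sqrt (1 - (r * m) ^ 2)) \<partial>seg 0 s) = ennreal (arcsin (s * m) - arcsin (0 * m))"
  proof (rule nn_integral_seg_FTC)
    fix r assume "0 \<le> r" "r \<le> s"
    then have "0 \<le> r * m" "r * m < 1"
      using assms by (auto intro: le_less_trans[OF mult_right_mono])
    then show "((\<lambda>r. arcsin (r * m)) has_real_derivative m / sqrt (1 - (r * m) ^ 2)) (at r)"
      and "0 \<le> m / sqrt (1 - (r * m) ^ 2)"
      using \<open>0 \<le> m\<close> by (auto intro!: derivative_eq_intros simp: divide_inverse power_le_one abs_square_le_1)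
  qed (use assms in auto)
  then show ?thesis by simp
qed

text \<open>The substitution \<open>u = sin t\<close> gives \<open>\<integral>\<^sub>0\<^sup>1 du / sqrt (1 - r\<^sup>2 + r\<^sup>2 u\<^sup>2)\<close>, an inverse hyperbolic sine
  whose value at the end point is \<open>artanh r / r\<close>.\<close>
lemma nn_integral_cos_kernel:
  assumes "0 < r" "r < 1"
  shows "(\<integral>\<^sup>+t. ennreal (cos t / sqrt (1 - (r * cos t) ^ 2)) \<partial>seg 0 (pi / 2)) = ennreal (artanh r / r)"
proof -
  define w where "w = sqrt (1 - r ^ 2)"
  have w: "0 < w" "w ^ 2 = 1 - r ^ 2"
    using assms by (auto simp: w_def power_less_one_iff abs_square_less_1 power_le_one)
  \<comment> \<open>chosen such that \<open>w sqrt (1 + k\<^sup>2 sin\<^sup>2 t) = sqrt (1 - r\<^sup>2 cos\<^sup>2 t)\<close>\<close>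
  define k where "k = r / w"
  have k: "0 < k" using w assms by (simp add: k_def)
  have sq: "w * sqrt (1 + (k * sin t) ^ 2) = sqrt (1 - (r * cos t) ^ 2)" for t
  proof -
    have "w ^ 2 * (1 + (k * sin t) ^ 2) = w ^ 2 + r ^ 2 * sin t ^ 2"
      using w(1) by (simp add: k_def field_simps)
    also have "\<dots> = 1 - (r * cos t) ^ 2"
      by (simp add: w sin_squared_eq algebra_simps)
    finally show ?thesis
      using w(1) by (metis abs_of_pos real_sqrt_abs real_sqrt_mult)
  qed
  have "(\<integral>\<^sup>+t. ennreal (cos t / sqrt (1 - (r * cos t) ^ 2)) \<partial>seg 0 (pi / 2))
      = ennreal (arsinh (k * sin (pi / 2)) / r - arsinh (k * sin 0) / r)"
  proof (rule nn_integral_seg_FTC)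
    fix t :: real assume t: "0 \<le> t" "t \<le> pi / 2"
    have pos: "0 < sqrt (1 + (k * sin t) ^ 2)"
      by (simp add: add_pos_nonneg)
    have "((\<lambda>t. arsinh (k * sin t) / r) has_real_derivative
        1 / sqrt ((k * sin t) ^ 2 + 1) * (k * cos t) / r) (at t)"
      by (intro DERIV_cdivide DERIV_chain2[OF arsinh_real_has_field_derivative]) (auto intro!: derivative_eq_intros)
    also have "1 / sqrt ((k * sin t) ^ 2 + 1) * (k * cos t) / r = cos t / (w * sqrt (1 + (k * sin t) ^ 2))"
      using assms by (simp add: k_def add.commute)
    finally show "((\<lambda>t. arsinh (k * sin t) / r) has_real_derivative cos t / sqrt (1 - (r * cos t) ^ 2)) (at t)"
      by (simp only: sq)
    have "0 \<le> sqrt (1 - (r * cos t) ^ 2)"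
      unfolding sq[symmetric] using pos w(1) by simp
    then show "0 \<le> cos t / sqrt (1 - (r * cos t) ^ 2)"
      using t by (auto intro!: divide_nonneg_nonneg cos_ge_zero)
  qed auto
  also have "\<dots> = ennreal (arsinh k / r)"
    by simp
  also have "arsinh k = artanh r"
  proof -
    have "w * sqrt (1 + k ^ 2) = 1"
      using sq[of "pi / 2"] by simp
    then have "sqrt (1 + k ^ 2) = 1 / w"
      using w(1) by (simp add: field_simps)
    then have "arsinh k = ln ((1 + r) / w)"
      by (simp add: arsinh_real_def k_def add.commute add_divide_distrib)
    also have "\<dots> = ln (1 + r) - ln (1 - r ^ 2) / 2"
    proof -
      have "ln w = ln (1 - r ^ 2) / 2"
        using w unfolding w_def by (intro ln_sqrt) simp
      then show ?thesis
        using assms w(1) by (simp add: ln_divide_pos)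
    qed
    also have "1 - r ^ 2 = (1 + r) * (1 - r)"
      by (simp add: power2_eq_square algebra_simps)
    also have "ln (1 + r) - ln ((1 + r) * (1 - r)) / 2 = artanh r"
      using assms ln_mult_pos[of "1 + r" "1 - r"] ln_divide_pos[of "1 + r" "1 - r"]
      unfolding artanh_def by linarith
    finally show ?thesis .
  qed
  finally show ?thesis .
qed

text \<open>Differentiating in \<open>s\<close> under the integral leads to the kernel above, hence to
  \<open>artanh r / r = \<chi>\<^sub>1(r) / r\<close>; integrating back raises the index of \<open>\<chi>\<close> by one.\<close>
lemma nn_integral_arcsin_cos:
  assumes "0 \<le> s" "s < 1"
  shows "(\<integral>\<^sup>+t. ennreal (arcsin (s * cos t)) \<partial>seg 0 (pi / 2)) = ennreal (legendre_chi 2 s)"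
proof -
  have "(\<integral>\<^sup>+t. ennreal (arcsin (s * cos t)) \<partial>seg 0 (pi / 2))
      = (\<integral>\<^sup>+t. \<integral>\<^sup>+r. ennreal (cos t / sqrt (1 - (r * cos t) ^ 2)) \<partial>seg 0 s \<partial>seg 0 (pi / 2))"
  proof (intro nn_integral_seg_cong nn_integral_arcsin_derivative[symmetric])
    fix t :: real assume "0 \<le> t" "t \<le> pi / 2"
    then show "0 \<le> cos t" by (auto intro: cos_ge_zero)
    show "s * cos t < 1"
      using assms mult_left_mono[of "cos t" 1 s] by simp
  qed (use assms in auto)
  also have "\<dots> = (\<integral>\<^sup>+r. \<integral>\<^sup>+t. ennreal (cos t / sqrt (1 - (r * cos t) ^ 2)) \<partial>seg 0 (pi / 2) \<partial>seg 0 s)"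
    by (rule seg_pair.Fubini') measurable
  also have "\<dots> = (\<integral>\<^sup>+r. ennreal (legendre_chi 1 r / r) \<partial>seg 0 s)"
    using assms by (intro nn_integral_cong_AE AE_seg[of "{0}"]) (auto simp: nn_integral_cos_kernel chi_1[simplified])
  also have "\<dots> = ennreal (legendre_chi 2 s)"
    using nn_integral_chi[of 1 s] assms by (simp add: numeral_2_eq_2)
  finally show ?thesis .
qed

text \<open>An integral of \<open>ln\<^sup>+ (c cos z / cos x)\<close>, as negative values are cut off by \<^const>\<open>ennreal\<close>.  Up to
  the factor \<open>4 / \<pi>\<^sup>2\<close> it is the Mahler measure of \<open>(1 + x) + c y (1 + z)\<close>.\<close>
definition log_ratio_mean :: "real \<Rightarrow> ennreal" where
  "log_ratio_mean c = (\<integral>\<^sup>+z. \<integral>\<^sup>+x. ennreal (ln (c * cos z / cos x)) \<partial>seg 0 (pi / 2) \<partial>seg 0 (pi / 2))"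

text \<open>For fixed \<open>s \<le> 1\<close> and \<open>z\<close>, the set of \<open>x\<close> with \<open>s cos z > cos x\<close> has measure
  \<open>arcsin (s cos z)\<close>.  Integrating over \<open>z\<close> gives \<open>\<chi>\<^sub>2(s)\<close>, and then \<open>\<integral>\<^sub>0\<^sup>c \<chi>\<^sub>2(s) ds / s = \<chi>\<^sub>3(c)\<close>.\<close>
lemma log_ratio_mean_le_1:
  assumes "0 < c" "c \<le> 1"
  shows "log_ratio_mean c = ennreal (legendre_chi 3 c)"
proof -
  have cos_pos: "0 < cos t" if "0 \<le> t" "t \<le> pi / 2" "t \<notin> {pi / 2}" for t :: real
    using that by (intro cos_gt_zero_pi) auto
  have "log_ratio_mean c = (\<integral>\<^sup>+z. \<integral>\<^sup>+x. \<integral>\<^sup>+s. ennreal (1 / s) * indicator {cos x / cos z<..} s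
      \<partial>seg 0 c \<partial>seg 0 (pi / 2) \<partial>seg 0 (pi / 2))"
    unfolding log_ratio_mean_def
    using assms by (intro nn_integral_cong_AE AE_seg[of "{pi / 2}"])
       (auto simp: nn_integral_inverse_above cos_pos)
  also have "\<dots> = (\<integral>\<^sup>+z. \<integral>\<^sup>+s. \<integral>\<^sup>+x. ennreal (1 / s) * indicator {cos x / cos z<..} s
      \<partial>seg 0 (pi / 2) \<partial>seg 0 c \<partial>seg 0 (pi / 2))"
    by (intro nn_integral_cong seg_pair.Fubini') (unfold indicator_def greaterThan_iff, measurable)
  also have "\<dots> = (\<integral>\<^sup>+s. \<integral>\<^sup>+z. \<integral>\<^sup>+x. ennreal (1 / s) * indicator {cos x / cos z<..} s
      \<partial>seg 0 (pi / 2) \<partial>seg 0 (pi / 2) \<partial>seg 0 c)"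
    by (intro seg_pair.Fubini') (unfold indicator_def greaterThan_iff, measurable)
  also have "\<dots> = (\<integral>\<^sup>+s. ennreal (legendre_chi 2 s / s) \<partial>seg 0 c)"
  proof (intro nn_integral_cong_AE AE_seg[of "{0, 1}"])
    fix s assume "0 \<le> s" "s \<le> c" "s \<notin> {0, 1}"
    then have s: "0 < s" "s < 1" using assms by auto
    have "(\<integral>\<^sup>+z. \<integral>\<^sup>+x. ennreal (1 / s) * indicator {cos x / cos z<..} s \<partial>seg 0 (pi / 2) \<partial>seg 0 (pi / 2))
       = (\<integral>\<^sup>+z. ennreal (1 / s) * ennreal (arcsin (s * cos z)) \<partial>seg 0 (pi / 2))"
    proof (intro nn_integral_cong_AE AE_seg[of "{pi / 2}"])
      fix z :: real assume z: "0 \<le> z" "z \<le> pi / 2" "z \<notin> {pi / 2}"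
      have "s * cos z \<le> 1" "0 \<le> s * cos z"
        using s mult_mono[of s 1 "cos z" 1] cos_pos[OF z] by auto
      have "(\<integral>\<^sup>+x. ennreal (1 / s) * indicator {cos x / cos z<..} s \<partial>seg 0 (pi / 2))
        = (\<integral>\<^sup>+x. ennreal (1 / s) * indicator {x. cos x < s * cos z} x \<partial>seg 0 (pi / 2))"
        using cos_pos[OF z] by (intro nn_integral_cong) (auto simp: indicator_def divide_less_eq)
      also have "\<dots> = ennreal (1 / s) * ennreal (arcsin (s * cos z))"
        using \<open>s * cos z \<le> 1\<close> \<open>0 \<le> s * cos z\<close> by (simp add: nn_integral_cmult emeasure_cos_less)
      finally show "(\<integral>\<^sup>+x. ennreal (1 / s) * indicator {cos x / cos z<..} s \<partial>seg 0 (pi / 2))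
         = ennreal (1 / s) * ennreal (arcsin (s * cos z))" .
    qed simp
    also have "\<dots> = ennreal (1 / s) * ennreal (legendre_chi 2 s)"
    proof (subst nn_integral_cmult)
      have "\<bar>s * cos z\<bar> \<le> 1" for z
        using s mult_mono[of s 1 "\<bar>cos z\<bar>" 1] by (simp add: abs_mult)
      then have "continuous_on UNIV (\<lambda>z. arcsin (s * cos z))"
        by (intro continuous_intros) (auto simp: abs_le_iff minus_le_iff)
      then show "(\<lambda>z. ennreal (arcsin (s * cos z))) \<in> borel_measurable (seg 0 (pi / 2))"
        by (intro measurable_compose[OF _ measurable_ennreal]) (auto dest: borel_measurable_continuous_onI)
    qed (use s in \<open>simp add: nn_integral_arcsin_cos\<close>)
    also have "\<dots> = ennreal (legendre_chi 2 s / s)"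
      using s by (simp add: chi_nonneg mult.commute flip: ennreal_mult')
    finally show "(\<integral>\<^sup>+z. \<integral>\<^sup>+x. ennreal (1 / s) * indicator {cos x / cos z<..} s \<partial>seg 0 (pi / 2) \<partial>seg 0 (pi / 2))
       = ennreal (legendre_chi 2 s / s)" .
  qed simp
  also have "\<dots> = ennreal (legendre_chi 3 c)"
    using nn_integral_chi[of 2 c] assms by (simp add: numeral_3_eq_3)
  finally show ?thesis .
qed

text \<open>Reflection: \<open>ln\<^sup>+ u = ln u + ln\<^sup>+ (1 / u)\<close>, and in the mean of \<open>ln (c cos z / cos x)\<close> the two cosines
  cancel by symmetry, leaving \<open>ln c\<close> times the area \<open>\<pi>\<^sup>2 / 4\<close>.\<close>
lemma log_ratio_mean_ge_1:
  assumes "1 \<le> c"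
  shows "log_ratio_mean c = ennreal (pi ^ 2 / 4 * ln c + legendre_chi 3 (1 / c))"
proof -
  let ?Q = quarter
  \<comment> \<open>the finite mean of \<open>- ln cos\<close>, added on both sides to keep every term nonnegative\<close>
  define \<Lambda> where "\<Lambda> = (\<integral>\<^sup>+t. ennreal (- ln (cos t)) \<partial>?Q)"
  have fin: "ennreal (pi / 2) * \<Lambda> \<noteq> top"
    using nn_integral_minus_ln_cos_quarter by (simp add: \<Lambda>_def ennreal_mult_eq_top_iff)
  have cos_pos: "0 < cos t" if "0 \<le> t" "t \<le> pi / 2" "t \<notin> {pi / 2}" for t :: real
    using that by (intro cos_gt_zero_pi) auto
  have "ennreal (pi / 2) * \<Lambda> + log_ratio_mean c
    = (\<integral>\<^sup>+z. \<integral>\<^sup>+x. ennreal (- ln (cos z)) + ennreal (ln (c * cos z / cos x)) \<partial>?Q \<partial>?Q)"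
    by (simp add: nn_integral_add log_ratio_mean_def \<Lambda>_def emeasure_seg_UNIV nn_integral_multc mult.commute)
  also have "\<dots> = (\<integral>\<^sup>+z. \<integral>\<^sup>+x. ennreal (- ln (cos x)) + (ennreal (ln c) + ennreal (ln (1 / c * cos x / cos z))) \<partial>?Q \<partial>?Q)"
  proof (intro nn_integral_cong_AE AE_seg[of "{pi / 2}"])
    fix z x :: real assume z: "0 \<le> z" "z \<le> pi / 2" "z \<notin> {pi / 2}" and x: "0 \<le> x" "x \<le> pi / 2" "x \<notin> {pi / 2}"
    have "ln (cos z) \<le> 0" "ln (cos x) \<le> 0" "0 \<le> ln c"
      using cos_pos[OF z] cos_pos[OF x] assms by (auto simp: ln_le_zero_iff)
    moreover have "ln (c * cos z / cos x) = ln c + ln (cos z) - ln (cos x)"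
      using cos_pos[OF z] cos_pos[OF x] assms by (simp add: ln_mult_pos ln_divide_pos)
    moreover have "ln (1 / c * cos x / cos z) = - (ln c + ln (cos z) - ln (cos x))"
      using cos_pos[OF z] cos_pos[OF x] assms by (simp add: ln_mult_pos ln_divide_pos)
    ultimately show "ennreal (- ln (cos z)) + ennreal (ln (c * cos z / cos x))
       = ennreal (- ln (cos x)) + (ennreal (ln c) + ennreal (ln (1 / c * cos x / cos z)))"
      by (cases "0 \<le> ln (c * cos z / cos x)") (simp_all add: ennreal_neg flip: ennreal_plus)
  qed auto
  also have "\<dots> = ennreal (pi / 2) * \<Lambda> + (ennreal (pi / 2) * (ennreal (pi / 2) * ennreal (ln c))
      + (\<integral>\<^sup>+z. \<integral>\<^sup>+x. ennreal (ln (1 / c * cos x / cos z)) \<partial>?Q \<partial>?Q))"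
    by (simp add: nn_integral_add \<Lambda>_def emeasure_seg_UNIV nn_integral_multc mult.commute)
  also have "(\<integral>\<^sup>+z. \<integral>\<^sup>+x. ennreal (ln (1 / c * cos x / cos z)) \<partial>?Q \<partial>?Q) = log_ratio_mean (1 / c)"
    unfolding log_ratio_mean_def by (rule seg_pair.Fubini') measurable
  also have "\<dots> = ennreal (legendre_chi 3 (1 / c))"
    using assms by (intro log_ratio_mean_le_1) auto
  finally have "log_ratio_mean c = ennreal (pi / 2) * (ennreal (pi / 2) * ennreal (ln c)) + ennreal (legendre_chi 3 (1 / c))"
    using fin by (subst (asm) ennreal_add_left_cancel) auto
  also have "\<dots> = ennreal (pi ^ 2 / 4 * ln c + legendre_chi 3 (1 / c))"
    using assms by (simp add: chi_nonneg power2_eq_square flip: ennreal_mult ennreal_plus)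
  finally show ?thesis .
qed

section \<open>Integration over the first variable\<close>

lemma set_integrable_bounded_Icc:
  fixes f :: "real \<Rightarrow> 'a :: {banach, second_countable_topology}"
  assumes "f \<in> borel_measurable borel" and "\<And>x. a \<le> x \<Longrightarrow> x \<le> b \<Longrightarrow> norm (f x) \<le> K"
  shows "set_integrable lborel {a..b} f"
  unfolding set_integrable_def
  by (rule integrableI_bounded_set_indicator[where B = K])
     (use assms in \<open>auto simp: emeasure_lborel_Icc_eq\<close>)

lemma nn_integral_seg_eq_LBINT:
  assumes "f \<in> borel_measurable borel"
    and "\<And>x. a \<le> x \<Longrightarrow> x \<le> b \<Longrightarrow> 0 \<le> f x" and "\<And>x. a \<le> x \<Longrightarrow> x \<le> b \<Longrightarrow> f x \<le> K"
  shows "(\<integral>\<^sup>+x. ennreal (f x) \<partial>seg a b) = ennreal (LBINT x:{a..b}. f x)"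
proof -
  have "set_integrable lborel {a..b} f"
    using assms by (intro set_integrable_bounded_Icc[where K = K]) auto
  then have "(\<integral>\<^sup>+x. ennreal (indicator {a..b} x *\<^sub>R f x) \<partial>lborel) = ennreal (LBINT x:{a..b}. f x)"
    unfolding set_integrable_def set_lebesgue_integral_def
    using assms(2) by (intro nn_integral_eq_integral) (auto simp: indicator_def)
  moreover have "(\<integral>\<^sup>+x. ennreal (f x) \<partial>seg a b) = (\<integral>\<^sup>+x. ennreal (indicator {a..b} x *\<^sub>R f x) \<partial>lborel)"
    using assms(1) by (subst nn_integral_seg) (auto intro!: nn_integral_cong simp: indicator_def)
  ultimately show ?thesis by simp
qed

lemma LBINT_nonneg:
  fixes f :: "real \<Rightarrow> real"
  assumes "\<And>x. a \<le> x \<Longrightarrow> x \<le> b \<Longrightarrow> 0 \<le> f x"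
  shows "0 \<le> (LBINT x:{a..b}. f x)"
  unfolding set_lebesgue_integral_def using assms by (intro Bochner_Integration.integral_nonneg) (auto simp: indicator_def)

lemma chi_le_chi_1: "0 \<le> t \<Longrightarrow> t \<le> 1 \<Longrightarrow> 2 \<le> p \<Longrightarrow> legendre_chi p t \<le> legendre_chi p 1"
  unfolding legendre_chi_def by (intro suminf_le summable_chi) (auto intro!: divide_right_mono power_le_one)

lemma borel_measurable_tan [measurable]: "(tan :: real \<Rightarrow> real) \<in> borel_measurable borel"
  unfolding tan_def[abs_def] by measurable

lemma borel_measurable_log_ratio_mean [measurable]: "log_ratio_mean \<in> borel_measurable borel"
  unfolding log_ratio_mean_def[abs_def] by measurable

lemma DERIV_arctan_scaled:
  assumes "0 < a"
  shows "((\<lambda>s. arctan (s / a)) has_real_derivative a / (a ^ 2 + s ^ 2)) (at s)"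
    and "((\<lambda>s. arctan (a * s)) has_real_derivative a / (1 + (a * s) ^ 2)) (at s)"
proof -
  have "1 / a / (1 + (s / a) ^ 2) = a / (a ^ 2 + s ^ 2)"
    using assms by (simp add: field_simps power2_eq_square)
  then show "((\<lambda>s. arctan (s / a)) has_real_derivative a / (a ^ 2 + s ^ 2)) (at s)"
    using assms by (auto intro!: derivative_eq_intros simp: divide_inverse mult_ac)
  show "((\<lambda>s. arctan (a * s)) has_real_derivative a / (1 + (a * s) ^ 2)) (at s)"
    by (auto intro!: derivative_eq_intros simp: divide_inverse mult_ac)
qed

lemma arctan_le_self:
  assumes "0 \<le> x"
  shows "arctan x \<le> (x :: real)"
proof -
  have "0 - arctan 0 \<le> x - arctan x"
  proof (rule DERIV_nonneg_imp_nondecreasing[OF assms])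
    fix y :: real
    have "((\<lambda>y. y - arctan y) has_real_derivative 1 - inverse (1 + y ^ 2)) (at y)"
      by (auto intro!: derivative_eq_intros)
    moreover have "0 \<le> 1 - inverse (1 + y ^ 2)"
      by (simp add: inverse_le_1_iff)
    ultimately show "\<exists>d. ((\<lambda>y. y - arctan y) has_real_derivative d) (at y) \<and> 0 \<le> d"
      by blast
  qed
  then show ?thesis by simp
qed

text \<open>This dilogarithm-type integral is the contribution of the term \<open>ln c\<close> in the reflection
  formula.\<close>
lemma nn_integral_ln_arctan:
  assumes "0 < a"
  shows "(\<integral>\<^sup>+s. ennreal (- ln s) * ennreal (a / (1 + (a * s) ^ 2)) \<partial>seg 0 1)
           = ennreal (LBINT s:{0..1}. arctan (a * s) / s)"
proof -
  have "(\<integral>\<^sup>+s. ennreal (- ln s) * ennreal (a / (1 + (a * s) ^ 2)) \<partial>seg 0 1)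
      = (\<integral>\<^sup>+r. ennreal (1 / r) * (\<integral>\<^sup>+s. ennreal (a / (1 + (a * s) ^ 2)) \<partial>seg 0 r) \<partial>seg 0 1)"
    by (rule nn_integral_minus_ln_weight) measurable
  also have "\<dots> = (\<integral>\<^sup>+r. ennreal (arctan (a * r) / r) \<partial>seg 0 1)"
  proof (intro nn_integral_seg_cong)
    fix r :: real assume "0 \<le> r" "r \<le> 1"
    then have "(\<integral>\<^sup>+s. ennreal (a / (1 + (a * s) ^ 2)) \<partial>seg 0 r) = ennreal (arctan (a * r) - arctan (a * 0))"
      using assms by (intro nn_integral_seg_FTC DERIV_arctan_scaled) (auto simp: add_nonneg_nonneg)
    with \<open>0 \<le> r\<close> show "ennreal (1 / r) * (\<integral>\<^sup>+s. ennreal (a / (1 + (a * s) ^ 2)) \<partial>seg 0 r) = ennreal (arctan (a * r) / r)"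
      by (simp flip: ennreal_mult')
  qed
  also have "\<dots> = ennreal (LBINT s:{0..1}. arctan (a * s) / s)"
  proof (rule nn_integral_seg_eq_LBINT[where K = a])
    fix s :: real assume "0 \<le> s" "s \<le> 1"
    then show "0 \<le> arctan (a * s) / s" "arctan (a * s) / s \<le> a"
      using assms arctan_le_self[of "a * s"] by (auto simp: divide_le_eq)
  qed measurable
  finally show ?thesis .
qed

text \<open>The common value of both sides of the theorem, up to a factor \<open>8\<close>: on the Mahler side it
  arises as a triple integral of \<open>ln\<^sup>+\<close>, on the polylogarithm side as a sum of iterated integrals.\<close>
definition mahler_integrals :: "real \<Rightarrow> real" where
  "mahler_integrals a = (LBINT s:{0..1}. legendre_chi 3 s * (a / (a ^ 2 + s ^ 2))) + (LBINT s:{0..1}. legendre_chi 3 s * (a / (1 + (a * s) ^ 2)))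
     + pi ^ 2 / 4 * (LBINT s:{0..1}. arctan (a * s) / s)"

lemma mahler_integrals_summands_nonneg:
  assumes "0 < a"
  shows "0 \<le> (LBINT s:{0..1}. legendre_chi 3 s * (a / (a ^ 2 + s ^ 2)))"
    and "0 \<le> (LBINT s:{0..1}. legendre_chi 3 s * (a / (1 + (a * s) ^ 2)))"
    and "0 \<le> (LBINT s:{0..1}. arctan (a * s) / s)"
  by (rule LBINT_nonneg, rule mult_nonneg_nonneg, rule chi_nonneg;
      use assms in \<open>simp add: add_nonneg_nonneg\<close>)+
     (rule LBINT_nonneg, use assms in simp)

text \<open>Here \<open>a tan w \<le> 1\<close>, and \<open>s = a tan w\<close> is the new variable.\<close>
lemma nn_integral_log_ratio_mean_small:
  assumes "0 < a"
  shows "(\<integral>\<^sup>+w. log_ratio_mean (a * tan w) \<partial>seg 0 (arctan (1 / a)))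
       = ennreal (LBINT s:{0..1}. legendre_chi 3 s * (a / (a ^ 2 + s ^ 2)))"
proof -
  have "(\<integral>\<^sup>+w. log_ratio_mean (a * tan w) \<partial>seg 0 (arctan (1 / a)))
      = (\<integral>\<^sup>+w. ennreal (legendre_chi 3 (a * tan w)) \<partial>seg 0 (arctan (1 / a)))"
  proof (intro nn_integral_cong_AE AE_seg[of "{0}"] log_ratio_mean_le_1)
    fix w :: real assume w: "0 \<le> w" "w \<le> arctan (1 / a)" "w \<notin> {0}"
    have "w < pi / 2"
      using w(2) arctan_ubound[of "1 / a"] by linarith
    then show "0 < a * tan w"
      using w assms by (auto intro!: mult_pos_pos tan_gt_zero)
    have "tan w \<le> 1 / a"
      using w \<open>w < pi / 2\<close> arctan_le_iff[of "tan w" "1 / a"] by (simp add: arctan_tan)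
    then show "a * tan w \<le> 1"
      using assms by (simp add: field_simps)
  qed simp
  also have "\<dots> = (\<integral>\<^sup>+s. ennreal (legendre_chi 3 (a * tan (arctan (s / a)))) * ennreal (a / (a ^ 2 + s ^ 2)) \<partial>seg 0 1)"
    using nn_integral_seg_substitution[of "\<lambda>w. ennreal (legendre_chi 3 (a * tan w))" 0 1 "\<lambda>s. arctan (s / a)" "\<lambda>s. a / (a ^ 2 + s ^ 2)"]
      assms by (simp add: DERIV_arctan_scaled sum_power2_eq_zero_iff continuous_intros)
  also have "\<dots> = (\<integral>\<^sup>+s. ennreal (legendre_chi 3 s * (a / (a ^ 2 + s ^ 2))) \<partial>seg 0 1)"
  proof (intro nn_integral_seg_cong)
    fix s :: real assume s: "0 \<le> s" "s \<le> 1"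
    have "a * tan (arctan (s / a)) = s"
      using assms by (simp add: tan_arctan)
    then show "ennreal (legendre_chi 3 (a * tan (arctan (s / a)))) * ennreal (a / (a ^ 2 + s ^ 2))
        = ennreal (legendre_chi 3 s * (a / (a ^ 2 + s ^ 2)))"
      using s assms by (subst ennreal_mult) (auto intro: chi_nonneg)
  qed
  also have "\<dots> = ennreal (LBINT s:{0..1}. legendre_chi 3 s * (a / (a ^ 2 + s ^ 2)))"
  proof (rule nn_integral_seg_eq_LBINT[where K = "legendre_chi 3 1 * (1 / a)"])
    fix s :: real assume s: "0 \<le> s" "s \<le> 1"
    have "a / (a ^ 2 + s ^ 2) \<le> a / a ^ 2"
      using assms by (intro divide_left_mono) (auto intro!: mult_pos_pos add_pos_nonneg)
    also have "\<dots> = 1 / a"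
      using assms by (simp add: power2_eq_square)
    finally show "legendre_chi 3 s * (a / (a ^ 2 + s ^ 2)) \<le> legendre_chi 3 1 * (1 / a)"
      using s assms by (intro mult_mono chi_le_chi_1 chi_nonneg) auto
    show "0 \<le> legendre_chi 3 s * (a / (a ^ 2 + s ^ 2))"
      using s assms by (intro mult_nonneg_nonneg chi_nonneg) auto
  qed measurable
  finally show ?thesis .
qed

text \<open>Here \<open>a tan w \<ge> 1\<close>, and \<open>s = 1 / (a tan w)\<close> is the new variable; the reflection
  \<open>w \<mapsto> \<pi>/2 - w\<close> makes this substitution increasing.\<close>
lemma nn_integral_log_ratio_mean_large:
  assumes "0 < a"
  shows "(\<integral>\<^sup>+w. log_ratio_mean (a * tan w) \<partial>seg (arctan (1 / a)) (pi / 2))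
       = ennreal ((LBINT s:{0..1}. legendre_chi 3 s * (a / (1 + (a * s) ^ 2))) + pi ^ 2 / 4 * (LBINT s:{0..1}. arctan (a * s) / s))"
proof -
  have comp: "arctan (1 / a) = pi / 2 - arctan a"
    using arctan_inverse[of a] assms unfolding inverse_eq_divide by simp
  have "(\<integral>\<^sup>+w. log_ratio_mean (a * tan w) \<partial>seg (arctan (1 / a)) (pi / 2))
      = (\<integral>\<^sup>+w. log_ratio_mean (a * tan (pi / 2 - w)) \<partial>seg 0 (arctan a))"
    unfolding comp
    using nn_integral_seg_reflect[where f = "\<lambda>w. log_ratio_mean (a * tan w)" and a = 0 and b = "arctan a" and t = "pi / 2"]
    by simp
  also have "\<dots> = (\<integral>\<^sup>+w. ennreal (pi ^ 2 / 4 * ln (a / tan w) + legendre_chi 3 (tan w / a)) \<partial>seg 0 (arctan a))"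
  proof (intro nn_integral_cong_AE AE_seg[of "{0}"])
    fix w :: real assume w: "0 \<le> w" "w \<le> arctan a" "w \<notin> {0}"
    have "w < pi / 2"
      using w(2) arctan_ubound[of a] by linarith
    have "0 < tan w"
      using w \<open>w < pi / 2\<close> by (auto intro!: tan_gt_zero)
    have "tan w \<le> a"
      using w \<open>w < pi / 2\<close> arctan_le_iff[of "tan w" a] by (simp add: arctan_tan)
    have "a * tan (pi / 2 - w) = a / tan w"
      by (simp only: tan_cot) (rule divide_inverse[symmetric])
    then show "log_ratio_mean (a * tan (pi / 2 - w)) = ennreal (pi ^ 2 / 4 * ln (a / tan w) + legendre_chi 3 (tan w / a))"
      using \<open>0 < tan w\<close> \<open>tan w \<le> a\<close> by (simp add: log_ratio_mean_ge_1)
  qed simp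
  also have "\<dots> = (\<integral>\<^sup>+s. ennreal (pi ^ 2 / 4 * ln (a / tan (arctan (a * s))) + legendre_chi 3 (tan (arctan (a * s)) / a))
      * ennreal (a / (1 + (a * s) ^ 2)) \<partial>seg 0 1)"
    using nn_integral_seg_substitution[of "\<lambda>w. ennreal (pi ^ 2 / 4 * ln (a / tan w) + legendre_chi 3 (tan w / a))" 0 1
        "\<lambda>s. arctan (a * s)" "\<lambda>s. a / (1 + (a * s) ^ 2)"] assms
    by (simp add: DERIV_arctan_scaled continuous_intros add_nonneg_eq_0_iff)
  also have "\<dots> = (\<integral>\<^sup>+s. ennreal (pi ^ 2 / 4) * (ennreal (- ln s) * ennreal (a / (1 + (a * s) ^ 2)))
      + ennreal (legendre_chi 3 s * (a / (1 + (a * s) ^ 2))) \<partial>seg 0 1)"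
  proof (intro nn_integral_cong_AE AE_seg[of "{0}"])
    fix s :: real assume s: "0 \<le> s" "s \<le> 1" "s \<notin> {0}"
    define l k where "l = - ln s" and "k = a / (1 + (a * s) ^ 2)"
    have nonneg: "0 \<le> l" "0 \<le> legendre_chi 3 s" "0 \<le> k"
      using s assms by (auto intro: chi_nonneg simp: l_def k_def)
    have tan: "ln (a / tan (arctan (a * s))) = l" "tan (arctan (a * s)) / a = s"
      using s assms by (auto simp: tan_arctan l_def ln_divide_pos ln_mult_pos)
    have "ennreal (pi ^ 2 / 4 * l + legendre_chi 3 s) * ennreal k = ennreal (pi ^ 2 / 4 * (l * k) + legendre_chi 3 s * k)"
      using nonneg by (subst ennreal_mult[symmetric]) (auto simp: algebra_simps)
    also have "\<dots> = ennreal (pi ^ 2 / 4) * (ennreal l * ennreal k) + ennreal (legendre_chi 3 s * k)"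
      using nonneg by (simp only: ennreal_plus ennreal_mult mult_nonneg_nonneg zero_le_power2 zero_le_divide_iff
          zero_le_numeral simp_thms)
    finally show "ennreal (pi ^ 2 / 4 * ln (a / tan (arctan (a * s))) + legendre_chi 3 (tan (arctan (a * s)) / a))
        * ennreal (a / (1 + (a * s) ^ 2))
      = ennreal (pi ^ 2 / 4) * (ennreal (- ln s) * ennreal (a / (1 + (a * s) ^ 2)))
        + ennreal (legendre_chi 3 s * (a / (1 + (a * s) ^ 2)))"
      by (simp only: tan flip: l_def k_def)
  qed simp
  also have "\<dots> = ennreal (pi ^ 2 / 4) * ennreal (LBINT s:{0..1}. arctan (a * s) / s)
     + (\<integral>\<^sup>+s. ennreal (legendre_chi 3 s * (a / (1 + (a * s) ^ 2))) \<partial>seg 0 1)"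
    using assms by (simp add: nn_integral_add nn_integral_cmult nn_integral_ln_arctan)
  also have "(\<integral>\<^sup>+s. ennreal (legendre_chi 3 s * (a / (1 + (a * s) ^ 2))) \<partial>seg 0 1) = ennreal (LBINT s:{0..1}. legendre_chi 3 s * (a / (1 + (a * s) ^ 2)))"
  proof (rule nn_integral_seg_eq_LBINT[where K = "legendre_chi 3 1 * a"])
    fix s :: real assume s: "0 \<le> s" "s \<le> 1"
    have "a / (1 + (a * s) ^ 2) \<le> a / 1"
      using assms by (intro divide_left_mono) (auto intro!: mult_pos_pos add_pos_nonneg)
    then show "legendre_chi 3 s * (a / (1 + (a * s) ^ 2)) \<le> legendre_chi 3 1 * a"
      using s assms by (intro mult_mono chi_le_chi_1 chi_nonneg) auto
    show "0 \<le> legendre_chi 3 s * (a / (1 + (a * s) ^ 2))"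
      using s assms by (intro mult_nonneg_nonneg chi_nonneg) auto
  qed measurable
  finally show ?thesis
    using mahler_integrals_summands_nonneg[OF assms]
    by (simp only: ennreal_plus ennreal_mult' mult_nonneg_nonneg zero_le_power2 zero_le_divide_iff
        zero_le_numeral simp_thms add.commute)
qed

lemma mahler_integrals_nonneg: "0 < a \<Longrightarrow> 0 \<le> mahler_integrals a"
  unfolding mahler_integrals_def using mahler_integrals_summands_nonneg[of a] by (intro add_nonneg_nonneg mult_nonneg_nonneg) simp_all

lemma nn_integral_log_ratio_mean:
  assumes "0 < a"
  shows "(\<integral>\<^sup>+w. log_ratio_mean (a * tan w) \<partial>seg 0 (pi / 2)) = ennreal (mahler_integrals a)"
proof -
  have "(\<integral>\<^sup>+w. log_ratio_mean (a * tan w) \<partial>seg 0 (pi / 2))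
     = (\<integral>\<^sup>+w. log_ratio_mean (a * tan w) \<partial>seg 0 (arctan (1 / a)))
       + (\<integral>\<^sup>+w. log_ratio_mean (a * tan w) \<partial>seg (arctan (1 / a)) (pi / 2))"
  proof (intro nn_integral_seg_split)
    show "0 \<le> arctan (1 / a)" "arctan (1 / a) \<le> pi / 2"
      using assms arctan_ubound[of "1 / a"] by (simp_all add: less_imp_le)
  qed measurable
  also have "\<dots> = ennreal (mahler_integrals a)"
    unfolding mahler_integrals_def nn_integral_log_ratio_mean_small[OF assms] nn_integral_log_ratio_mean_large[OF assms] add.assoc
    by (intro ennreal_plus[symmetric] add_nonneg_nonneg mult_nonneg_nonneg mahler_integrals_summands_nonneg assms) simp
  finally show ?thesis .
qed

section \<open>The Mahler measure as an integral over a cube\<close>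

interpretation segs: product_sigma_finite "\<lambda>i :: nat. seg a b" for a b ..

lemma PiM_seg_eq_density:
  fixes n :: nat
  shows "density (Pi\<^sub>M {..<n} (\<lambda>_. lborel)) (indicator (\<Pi>\<^sub>E j\<in>{..<n}. {a..b})) = Pi\<^sub>M {..<n} (\<lambda>_. seg a b)"
proof (rule segs.PiM_eqI)
  interpret lb: product_sigma_finite "\<lambda>_ :: nat. lborel :: real measure" ..
  show "sets (density (Pi\<^sub>M {..<n} (\<lambda>_. lborel)) (indicator (\<Pi>\<^sub>E j\<in>{..<n}. {a..b}))) = sets (Pi\<^sub>M {..<n} (\<lambda>_. seg a b))"
    by (simp cong: sets_PiM_cong)
  fix A :: "nat \<Rightarrow> real set" assume "\<And>i. i \<in> {..<n} \<Longrightarrow> A i \<in> sets (seg a b)"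
  then have A [measurable]: "A i \<in> sets borel" if "i < n" for i
    using that by auto
  have "emeasure (density (Pi\<^sub>M {..<n} (\<lambda>_. lborel)) (indicator (\<Pi>\<^sub>E j\<in>{..<n}. {a..b}))) (Pi\<^sub>E {..<n} A)
     = emeasure (Pi\<^sub>M {..<n} (\<lambda>_. lborel)) (\<Pi>\<^sub>E j\<in>{..<n}. A j \<inter> {a..b})"
    using A by (subst emeasure_density)
      (auto intro!: sets_PiM_I_finite simp: PiE_Int nn_integral_set_ennreal Int_commute simp flip: indicator_inter_arith)
  also have "\<dots> = (\<Prod>i<n. emeasure lborel (A i \<inter> {a..b}))"
    using A by (subst lb.emeasure_PiM) auto
  also have "\<dots> = (\<Prod>i<n. emeasure (seg a b) (A i))"
    using A by (intro prod.cong) (auto simp: emeasure_seg)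
  finally show "emeasure (density (Pi\<^sub>M {..<n} (\<lambda>_. lborel)) (indicator (\<Pi>\<^sub>E j\<in>{..<n}. {a..b}))) (Pi\<^sub>E {..<n} A)
     = (\<Prod>i<n. emeasure (seg a b) (A i))" .
qed simp

lemma mahler_measure_eq_integral:
  assumes [measurable]: "(\<lambda>\<theta>. ln (norm (P (\<lambda>j. cis (\<theta> j))))) \<in> borel_measurable (Pi\<^sub>M {..<n} (\<lambda>_. lborel))"
  shows "mahler_measure n P
     = 1 / (2 * pi) ^ n * (\<integral>\<theta>. ln (norm (P (\<lambda>j. cis (\<theta> j)))) \<partial>Pi\<^sub>M {..<n} (\<lambda>_. seg 0 (2 * pi)))"
proof -
  have [measurable]: "(\<Pi>\<^sub>E j\<in>{..<n}. {0..2 * pi}) \<in> sets (Pi\<^sub>M {..<n} (\<lambda>_. lborel))"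
    by (intro sets_PiM_I_finite) auto
  have "(\<integral>\<theta>. ln (norm (P (\<lambda>j. cis (\<theta> j)))) \<partial>density (Pi\<^sub>M {..<n} (\<lambda>_. lborel))
      (\<lambda>\<theta>. ennreal (indicator (\<Pi>\<^sub>E j\<in>{..<n}. {0..2 * pi}) \<theta>)))
    = (LINT \<theta> : (\<Pi>\<^sub>E j\<in>{..<n}. {0..2*pi}) | (\<Pi>\<^sub>M j\<in>{..<n}. lborel). ln (norm (P (\<lambda>j. cis (\<theta> j)))))"
    unfolding set_lebesgue_integral_def by (rule integral_density) auto
  then show ?thesis
    unfolding mahler_measure_def by (simp add: ennreal_indicator PiM_seg_eq_density)
qed

lemma nn_integral_PiM_seg_4:
  assumes [measurable]: "(\<lambda>\<theta>. g (\<theta> 0) (\<theta> 1) (\<theta> 2) (\<theta> 3)) \<in> borel_measurable (Pi\<^sub>M {..<4 :: nat} (\<lambda>_. seg a b))"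
  shows "(\<integral>\<^sup>+\<theta>. g (\<theta> 0) (\<theta> 1) (\<theta> 2) (\<theta> 3) \<partial>Pi\<^sub>M {..<4 :: nat} (\<lambda>_. seg a b))
    = (\<integral>\<^sup>+w. \<integral>\<^sup>+x. \<integral>\<^sup>+y. \<integral>\<^sup>+z. g w x y z \<partial>seg a b \<partial>seg a b \<partial>seg a b \<partial>seg a b)"
proof -
  have eq: "{..<4 :: nat} = insert 3 (insert 2 (insert 1 (insert 0 {})))"
    by auto
  have [measurable]: "(\<lambda>\<theta>. g (\<theta> 0) (\<theta> 1) (\<theta> 2) (\<theta> 3))
      \<in> borel_measurable (Pi\<^sub>M (insert 3 (insert 2 (insert 1 (insert (0::nat) {})))) (\<lambda>_. seg a b))"
    using assms by (simp only: eq)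
  show ?thesis
    unfolding eq
    by (subst segs.product_nn_integral_insert; (simp; fail)?; (measurable; fail)?)+
       (simp add: PiM_empty)
qed

lemma norm_one_plus_cis: "norm (1 + cis t) = 2 * \<bar>cos (t / 2)\<bar>"
proof -
  have "1 + cis t = cis (t / 2) * (2 * of_real (cos (t / 2)))"
  proof -
    have "cis (t / 2) * (cis (t / 2) + cis (- (t / 2))) = cis t + 1"
      by (simp add: algebra_simps cis_mult)
    moreover have "cis (t / 2) + cis (- (t / 2)) = 2 * of_real (cos (t / 2))"
      by (simp add: complex_eq_iff)
    ultimately show ?thesis by simp
  qed
  then show ?thesis by (simp add: norm_mult)
qed

lemma norm_one_minus_cis: "norm (1 - cis t) = 2 * \<bar>sin (t / 2)\<bar>"
proof -
  have "1 - cis t = cis (t / 2) * (- 2 * \<i> * of_real (sin (t / 2)))"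
  proof -
    have "cis (t / 2) * (cis (- (t / 2)) - cis (t / 2)) = 1 - cis t"
      by (simp add: algebra_simps cis_mult)
    moreover have "cis (- (t / 2)) - cis (t / 2) = - 2 * \<i> * of_real (sin (t / 2))"
      by (simp add: complex_eq_iff)
    ultimately show ?thesis by simp
  qed
  then show ?thesis by (simp add: norm_mult)
qed

text \<open>Rotating \<open>z\<close> by \<open>y\<close> replaces \<open>y + z\<close> by \<open>y (1 + z)\<close>, after which Jensen's formula applies
  in \<open>y\<close>.\<close>
lemma jensen_two_variables:
  assumes C: "ln (norm A + 2 * norm B) \<le> C" "0 \<le> C"
  shows "(\<integral>\<^sup>+y. \<integral>\<^sup>+z. ennreal (C - ln (norm (A + B * (cis y + cis z)))) \<partial>circle \<partial>circle)
       = (\<integral>\<^sup>+z. ennreal (2 * pi * (C - ln (max (norm A) (norm B * norm (1 + cis z))))) \<partial>circle)"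
proof -
  have "(\<integral>\<^sup>+y. \<integral>\<^sup>+z. ennreal (C - ln (norm (A + B * (cis y + cis z)))) \<partial>circle \<partial>circle)
     = (\<integral>\<^sup>+y. \<integral>\<^sup>+z. ennreal (C - ln (norm (A + B * (cis y + cis (z + y))))) \<partial>circle \<partial>circle)"
  proof (rule nn_integral_seg_cong)
    fix y assume "0 \<le> y" "y \<le> 2 * pi"
    then show "(\<integral>\<^sup>+z. ennreal (C - ln (norm (A + B * (cis y + cis z)))) \<partial>circle)
       = (\<integral>\<^sup>+z. ennreal (C - ln (norm (A + B * (cis y + cis (z + y))))) \<partial>circle)"
      by (intro nn_integral_circle_shift[symmetric, of "\<lambda>z. ennreal (C - ln (norm (A + B * (cis y + cis z))))"])
         (auto simp: cis_pi_shift)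
  qed
  also have "\<dots> = (\<integral>\<^sup>+z. \<integral>\<^sup>+y. ennreal (C - ln (norm (A + B * (1 + cis z) * cis y))) \<partial>circle \<partial>circle)"
    by (subst seg_pair.Fubini') (simp_all add: algebra_simps cis_mult)
  also have "\<dots> = (\<integral>\<^sup>+z. ennreal (2 * pi * (C - ln (max (norm A) (norm (B * (1 + cis z)))))) \<partial>circle)"
  proof (intro nn_integral_cong jensen_linear)
    fix z
    have "norm (B * (1 + cis z)) \<le> 2 * norm B"
      using mult_left_mono[OF norm_triangle_ineq[of 1 "cis z"], of "norm B"] by (simp add: norm_mult)
    then have le: "norm A + norm (B * (1 + cis z)) \<le> norm A + 2 * norm B"
      by simp
    show "ln (norm A + norm (B * (1 + cis z))) \<le> C"
    proof (cases "norm A + norm (B * (1 + cis z)) = 0")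
      case False
      then have "0 < norm A + norm (B * (1 + cis z))"
        by (metis add_nonneg_nonneg norm_ge_zero order_le_less)
      then have "ln (norm A + norm (B * (1 + cis z))) \<le> ln (norm A + 2 * norm B)"
        using le by (subst ln_le_cancel_iff) auto
      then show ?thesis using C by simp
    next
      case True
      then show ?thesis using C by (simp only: ln_0)
    qed
  qed
  finally show ?thesis
    by (simp only: norm_mult)
qed

text \<open>Jensen's formula for \<open>1 + x\<close>: the logarithmic mean of \<open>2 cos\<close> is zero.\<close>
lemma nn_integral_ln_cos_quarter:
  assumes "ln 2 \<le> C"
  shows "(\<integral>\<^sup>+t. ennreal (C - ln (2 * cos t)) \<partial>quarter) = ennreal (pi / 2 * C)"
proof -
  have "0 \<le> C"
    using assms ln_ge_zero[of 2] by linarith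
  have "4 * (\<integral>\<^sup>+t. ennreal (C - ln (2 * cos t)) \<partial>quarter) = (\<integral>\<^sup>+t. ennreal (C - ln (2 * \<bar>cos (t / 2)\<bar>)) \<partial>circle)"
    by (rule nn_integral_circle_quarter[symmetric]) measurable
  also have "\<dots> = ennreal (2 * pi * C)"
    using jensen_linear[of 1 1 C] assms by (simp add: norm_one_plus_cis)
  also have "\<dots> = 4 * ennreal (pi / 2 * C)"
    using \<open>0 \<le> C\<close> by (subst ennreal_numeral[symmetric], subst ennreal_mult[symmetric]) auto
  finally show ?thesis
    by (simp add: ennreal_mult_cancel_left)
qed

text \<open>Pointwise, \<open>ln (max p q) = ln p + ln\<^sup>+ (q / p)\<close>.  The first part has mean zero by the preceding
  lemma; the second has quotient \<open>q / p = a tan w cos z / cos x\<close>.  The equation is stated additively because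
  subtraction of extended nonnegative reals is truncated.\<close>
lemma nn_integral_max_quarter:
  assumes a: "0 < a" and C: "ln (4 + 4 * a) \<le> C"
  shows "(\<integral>\<^sup>+w. \<integral>\<^sup>+x. \<integral>\<^sup>+z. ennreal (C - ln (max (4 * cos w * cos x) (4 * a * sin w * cos z)))
            \<partial>quarter \<partial>quarter \<partial>quarter) + ennreal (mahler_integrals a) = ennreal (pi ^ 3 / 8 * C)"
proof -
  have "ln 4 \<le> ln (4 + 4 * a)"
    using a by (subst ln_le_cancel_iff) auto
  moreover have "ln 4 = 2 * ln (2 :: real)"
    using ln_realpow[of 2 2] by simp
  \<comment> \<open>the constant is shared equally between \<open>2 cos w\<close> and \<open>2 cos x\<close>\<close>
  ultimately have C2: "ln 2 \<le> C / 2" using C by linarith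
  have cos_pos: "0 < cos t" if "0 \<le> t" "t \<le> pi / 2" "t \<notin> {0, pi / 2}" for t :: real
    using that by (intro cos_gt_zero_pi) auto
  have sin_pos: "0 < sin t" if "0 \<le> t" "t \<le> pi / 2" "t \<notin> {0, pi / 2}" for t :: real
    using that pi_gt_zero by (intro sin_gt_zero) auto
  have "ennreal (mahler_integrals a) = (\<integral>\<^sup>+w. log_ratio_mean (a * tan w) \<partial>quarter)"
    using a by (simp only: nn_integral_log_ratio_mean)
  also have "\<dots> = (\<integral>\<^sup>+w. \<integral>\<^sup>+x. \<integral>\<^sup>+z. ennreal (ln (a * tan w * cos z / cos x)) \<partial>quarter \<partial>quarter \<partial>quarter)"
    unfolding log_ratio_mean_def by (intro nn_integral_cong seg_pair.Fubini') measurable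
  finally have V: "ennreal (mahler_integrals a) = \<dots>" .
  have "(\<integral>\<^sup>+w. \<integral>\<^sup>+x. \<integral>\<^sup>+z. ennreal (C - ln (max (4 * cos w * cos x) (4 * a * sin w * cos z)))
            \<partial>quarter \<partial>quarter \<partial>quarter) + ennreal (mahler_integrals a)
     = (\<integral>\<^sup>+w. \<integral>\<^sup>+x. \<integral>\<^sup>+z. ennreal (C - ln (max (4 * cos w * cos x) (4 * a * sin w * cos z)))
            + ennreal (ln (a * tan w * cos z / cos x)) \<partial>quarter \<partial>quarter \<partial>quarter)"
    unfolding V by (simp add: nn_integral_add)
  also have "\<dots> = (\<integral>\<^sup>+w. \<integral>\<^sup>+x. \<integral>\<^sup>+z. ennreal (C / 2 - ln (2 * cos w)) + ennreal (C / 2 - ln (2 * cos x)) \<partial>quarter \<partial>quarter \<partial>quarter)"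
  proof (intro nn_integral_cong_AE AE_seg[of "{0, pi / 2}"])
    fix w x z :: real
    assume w: "0 \<le> w" "w \<le> pi / 2" "w \<notin> {0, pi / 2}" and x: "0 \<le> x" "x \<le> pi / 2" "x \<notin> {0, pi / 2}"
      and z: "0 \<le> z" "z \<le> pi / 2" "z \<notin> {0, pi / 2}"
    define p q where "p = 4 * cos w * cos x" and "q = 4 * a * sin w * cos z"
    have pos: "0 < p" "0 < q"
      using cos_pos[OF w] cos_pos[OF x] cos_pos[OF z] sin_pos[OF w] a by (simp_all add: p_def q_def)
    have ratio: "a * tan w * cos z / cos x = q / p"
      using cos_pos[OF w] cos_pos[OF x] by (simp add: p_def q_def tan_def)
    have "cos w * cos x \<le> 1 * 1"
      using cos_pos[OF w] cos_pos[OF x] by (intro mult_mono) auto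
    then have p4: "p \<le> 4" by (simp add: p_def)
    have "sin w * cos z \<le> 1 * 1"
      using sin_pos[OF w] cos_pos[OF z] by (intro mult_mono) auto
    then have q4: "q \<le> 4 * a"
      using a by (simp add: q_def mult.assoc mult_le_cancel_left1)
    have "ln p \<le> ln (4 + 4 * a)" "ln q \<le> ln (4 + 4 * a)"
      using p4 q4 pos a by (subst ln_le_cancel_iff; simp)+
    then have le: "ln p \<le> C" "ln q \<le> C" using C by simp_all
    have "ln (2 * cos w) \<le> ln 2" "ln (2 * cos x) \<le> ln 2"
      using cos_pos[OF w] cos_pos[OF x] by (subst ln_le_cancel_iff; simp)+
    then have le2: "ln (2 * cos w) \<le> C / 2" "ln (2 * cos x) \<le> C / 2"
      using C2 by simp_all
    have split: "ln (2 * cos w) + ln (2 * cos x) = ln p"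
      using cos_pos[OF w] cos_pos[OF x] by (subst ln_mult_pos[symmetric]) (auto simp: p_def mult_ac)
    have "ennreal (C - ln (max p q)) + ennreal (ln (q / p)) = ennreal (C - ln p)"
    proof (cases "p \<le> q")
      case True
      then show ?thesis
        using pos le by (simp add: ln_divide_pos flip: ennreal_plus)
    next
      case False
      then show ?thesis
        using pos by (simp add: ln_divide_pos ennreal_neg max_def)
    qed
    also have "\<dots> = ennreal (C / 2 - ln (2 * cos w)) + ennreal (C / 2 - ln (2 * cos x))"
      using le2 split by (subst ennreal_plus[symmetric]) auto
    finally show "ennreal (C - ln (max (4 * cos w * cos x) (4 * a * sin w * cos z)))
            + ennreal (ln (a * tan w * cos z / cos x))
        = ennreal (C / 2 - ln (2 * cos w)) + ennreal (C / 2 - ln (2 * cos x))"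
      unfolding ratio p_def q_def .
  qed auto
  also have "\<dots> = ennreal (pi / 2 * C / 2) * ennreal (pi / 2) * ennreal (pi / 2)
      + ennreal (pi / 2 * C / 2) * ennreal (pi / 2) * ennreal (pi / 2)"
    using nn_integral_ln_cos_quarter[OF C2]
    by (simp add: nn_integral_add nn_integral_multc emeasure_seg_UNIV distrib_right)
  also have "\<dots> = ennreal (pi ^ 3 / 8 * C)"
  proof -
    have "0 \<le> C" using C2 ln_ge_zero[of 2] by linarith
    then show ?thesis
      by (simp add: power3_eq_cube flip: ennreal_mult ennreal_plus)
  qed
  finally show ?thesis .
qed

text \<open>The constant is an upper bound of \<open>ln \<bar>P\<bar>\<close> on the torus, so the integrand is nonnegative and Tonelli
  applies before integrability of \<open>ln \<bar>P\<bar>\<close> is known.\<close>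
lemma nn_integral_mahler_defect:
  assumes a: "0 < a" and C: "C = ln (4 + 4 * a)"
  shows "(\<integral>\<^sup>+w. \<integral>\<^sup>+x. \<integral>\<^sup>+y. \<integral>\<^sup>+z. ennreal (C - ln (norm ((1 + cis w) * (1 + cis x) + of_real a * (1 - cis w) * (cis y + cis z))))
            \<partial>circle \<partial>circle \<partial>circle \<partial>circle) + ennreal (128 * pi * mahler_integrals a) = ennreal ((2 * pi) ^ 4 * C)"
proof -
  \<comment> \<open>\<open>u\<close> and \<open>v\<close> stand for cosine and sine of \<open>w / 2\<close>, \<open>r\<close> and \<open>s\<close> for the cosines of \<open>x / 2\<close> and \<open>z / 2\<close>\<close>
  define G where "G u v r s = C - ln (max (4 * u * r) (4 * a * v * s))" for u v r s :: real
  have [measurable]: "(\<lambda>p. G (f1 p) (f2 p) (f3 p) (f4 p)) \<in> borel_measurable M"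
    if [measurable]: "f1 \<in> borel_measurable M" "f2 \<in> borel_measurable M" "f3 \<in> borel_measurable M" "f4 \<in> borel_measurable M"
    for f1 f2 f3 f4 and M :: "'m measure"
    unfolding G_def by measurable
  have "0 \<le> C" using a by (simp add: C)
  have "(\<integral>\<^sup>+w. \<integral>\<^sup>+x. \<integral>\<^sup>+y. \<integral>\<^sup>+z. ennreal (C - ln (norm ((1 + cis w) * (1 + cis x) + of_real a * (1 - cis w) * (cis y + cis z))))
            \<partial>circle \<partial>circle \<partial>circle \<partial>circle)
     = (\<integral>\<^sup>+w. \<integral>\<^sup>+x. \<integral>\<^sup>+z. ennreal (2 * pi) * ennreal (G \<bar>cos (w / 2)\<bar> \<bar>sin (w / 2)\<bar> \<bar>cos (x / 2)\<bar> \<bar>cos (z / 2)\<bar>)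
            \<partial>circle \<partial>circle \<partial>circle)"
  proof (rule nn_integral_cong, rule nn_integral_cong)
    fix w x :: real
    have A: "norm ((1 + cis w) * (1 + cis x)) = 4 * \<bar>cos (w / 2)\<bar> * \<bar>cos (x / 2)\<bar>"
      by (simp add: norm_mult norm_one_plus_cis)
    have B: "norm (of_real a * (1 - cis w)) = 2 * a * \<bar>sin (w / 2)\<bar>"
      using a by (simp add: norm_mult norm_one_minus_cis)
    have "\<bar>cos (w / 2)\<bar> * \<bar>cos (x / 2)\<bar> \<le> 1 * 1"
      by (intro mult_mono) auto
    moreover have "a * \<bar>sin (w / 2)\<bar> \<le> a * 1"
      using a by (intro mult_left_mono) auto
    ultimately have le: "norm ((1 + cis w) * (1 + cis x)) + 2 * norm (of_real a * (1 - cis w)) \<le> 4 + 4 * a"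
      unfolding A B by simp
    have "ln (norm ((1 + cis w) * (1 + cis x)) + 2 * norm (of_real a * (1 - cis w))) \<le> C"
    proof (cases "norm ((1 + cis w) * (1 + cis x)) + 2 * norm (of_real a * (1 - cis w)) = 0")
      case False
      then have "0 < norm ((1 + cis w) * (1 + cis x)) + 2 * norm (of_real a * (1 - cis w))"
        by (smt (verit) norm_ge_zero)
      then show ?thesis
        using le a unfolding C by (subst ln_le_cancel_iff) auto
    qed (use \<open>0 \<le> C\<close> in \<open>simp only: ln_0\<close>)
    note jensen = jensen_two_variables[OF this \<open>0 \<le> C\<close>]
    have "2 * a * v * (2 * s) = 4 * a * v * s" for v s :: real
      by simp
    moreover have "ennreal (2 * pi * X) = ennreal (2 * pi) * ennreal X" for X
      by (intro ennreal_mult') simp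
    ultimately show "(\<integral>\<^sup>+y. \<integral>\<^sup>+z. ennreal (C - ln (norm ((1 + cis w) * (1 + cis x) + of_real a * (1 - cis w) * (cis y + cis z))))
            \<partial>circle \<partial>circle)
      = (\<integral>\<^sup>+z. ennreal (2 * pi) * ennreal (G \<bar>cos (w / 2)\<bar> \<bar>sin (w / 2)\<bar> \<bar>cos (x / 2)\<bar> \<bar>cos (z / 2)\<bar>) \<partial>circle)"
      using jensen unfolding A B norm_one_plus_cis G_def by (simp only:)
  qed
  also have "\<dots> = ennreal (2 * pi) * (\<integral>\<^sup>+w. \<integral>\<^sup>+x. \<integral>\<^sup>+z. ennreal (G \<bar>cos (w / 2)\<bar> \<bar>sin (w / 2)\<bar> \<bar>cos (x / 2)\<bar> \<bar>cos (z / 2)\<bar>)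
            \<partial>circle \<partial>circle \<partial>circle)"
    by (simp add: nn_integral_cmult)
  also have "(\<integral>\<^sup>+w. \<integral>\<^sup>+x. \<integral>\<^sup>+z. ennreal (G \<bar>cos (w / 2)\<bar> \<bar>sin (w / 2)\<bar> \<bar>cos (x / 2)\<bar> \<bar>cos (z / 2)\<bar>) \<partial>circle \<partial>circle \<partial>circle)
      = (\<integral>\<^sup>+w. \<integral>\<^sup>+x. 4 * (\<integral>\<^sup>+z. ennreal (G \<bar>cos (w / 2)\<bar> \<bar>sin (w / 2)\<bar> \<bar>cos (x / 2)\<bar> (cos z)) \<partial>quarter) \<partial>circle \<partial>circle)"
    by (intro nn_integral_cong nn_integral_circle_quarter[of "\<lambda>c s. ennreal (G u v r c)" for u v r]) measurable
  also have "\<dots> = (\<integral>\<^sup>+w. 4 * (\<integral>\<^sup>+x. 4 * (\<integral>\<^sup>+z. ennreal (G \<bar>cos (w / 2)\<bar> \<bar>sin (w / 2)\<bar> (cos x) (cos z)) \<partial>quarter) \<partial>quarter) \<partial>circle)"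
    by (intro nn_integral_cong nn_integral_circle_quarter[of "\<lambda>c s. 4 * (\<integral>\<^sup>+z. ennreal (G u v c (cos z)) \<partial>quarter)" for u v]) measurable
  also have "\<dots> = 4 * (\<integral>\<^sup>+w. 4 * (\<integral>\<^sup>+x. 4 * (\<integral>\<^sup>+z. ennreal (G (cos w) (sin w) (cos x) (cos z)) \<partial>quarter) \<partial>quarter) \<partial>quarter)"
    by (intro nn_integral_circle_quarter[of "\<lambda>c s. 4 * (\<integral>\<^sup>+x. 4 * (\<integral>\<^sup>+z. ennreal (G c s (cos x) (cos z)) \<partial>quarter) \<partial>quarter)"]) measurable
  also have "\<dots> = 64 * (\<integral>\<^sup>+w. \<integral>\<^sup>+x. \<integral>\<^sup>+z. ennreal (G (cos w) (sin w) (cos x) (cos z)) \<partial>quarter \<partial>quarter \<partial>quarter)"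
    by (simp add: nn_integral_cmult mult.assoc[symmetric])
  finally have N: "(\<integral>\<^sup>+w. \<integral>\<^sup>+x. \<integral>\<^sup>+y. \<integral>\<^sup>+z. ennreal (C - ln (norm ((1 + cis w) * (1 + cis x) + of_real a * (1 - cis w) * (cis y + cis z))))
            \<partial>circle \<partial>circle \<partial>circle \<partial>circle)
     = ennreal (2 * pi) * (64 * (\<integral>\<^sup>+w. \<integral>\<^sup>+x. \<integral>\<^sup>+z. ennreal (G (cos w) (sin w) (cos x) (cos z)) \<partial>quarter \<partial>quarter \<partial>quarter))"
    (is "?N = _ * (64 * ?M)") .
  have "ennreal (2 * pi) * 64 = ennreal (2 * pi) * ennreal 64"
    by simp
  also have "\<dots> = ennreal (128 * pi)"
    by (subst ennreal_mult[symmetric]) simp_all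
  finally have "?N = ennreal (128 * pi) * ?M"
    unfolding N mult.assoc[symmetric] by (simp only:)
  moreover have "ennreal (128 * pi * mahler_integrals a) = ennreal (128 * pi) * ennreal (mahler_integrals a)"
    by (rule ennreal_mult) (use mahler_integrals_nonneg[OF a] in auto)
  ultimately have "?N + ennreal (128 * pi * mahler_integrals a) = ennreal (128 * pi) * (?M + ennreal (mahler_integrals a))"
    by (simp only: distrib_left)
  also have "?M + ennreal (mahler_integrals a) = ennreal (pi ^ 3 / 8 * C)"
    unfolding G_def by (rule nn_integral_max_quarter[OF a]) (simp add: C)
  also have "ennreal (128 * pi) * \<dots> = ennreal (128 * pi * (pi ^ 3 / 8 * C))"
    by (rule ennreal_mult[symmetric]) (use \<open>0 \<le> C\<close> in auto)
  also have "128 * pi * (pi ^ 3 / 8 * C) = (2 * pi) ^ 4 * C"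
    by (simp add: power4_eq_xxxx power3_eq_cube)
  finally show ?thesis .
qed

text \<open>Finiteness of the defect integral yields integrability of \<open>ln \<bar>P\<bar>\<close>, so the additive identity for
  \<open>C - ln \<bar>P\<bar>\<close> can be turned into the value of the integral of \<open>ln \<bar>P\<bar>\<close>.\<close>
lemma mahler_measure_eq_integrals:
  assumes a: "0 < a"
  shows "pi ^ 3 * mahler_measure 4 (\<lambda>X. let w = X 0; x = X 1; y = X 2; z = X 3
             in (1 + w) * (1 + x) + of_real a * (1 - w) * (y + z)) = 8 * mahler_integrals a"
proof -
  define C where "C = ln (4 + 4 * a)"
  define P :: "(nat \<Rightarrow> complex) \<Rightarrow> complex" where
    "P X = (1 + X 0) * (1 + X 1) + of_real a * (1 - X 0) * (X 2 + X 3)" for X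
  define T where "T = Pi\<^sub>M {..<4 :: nat} (\<lambda>_. circle)"
  define f where "f \<theta> = ln (norm (P (\<lambda>j. cis (\<theta> j))))" for \<theta>
  interpret T: finite_measure T
    unfolding T_def by (intro finite_measureI) (simp add: segs.emeasure_PiM space_PiM emeasure_seg_UNIV ennreal_power)
  have meas: "f \<in> borel_measurable (Pi\<^sub>M {..<4 :: nat} (\<lambda>_. lborel))"
    unfolding f_def[abs_def] P_def by measurable
  have "sets T = sets (Pi\<^sub>M {..<4 :: nat} (\<lambda>_. lborel))"
    unfolding T_def by (intro sets_PiM_cong) simp_all
  then have [measurable]: "f \<in> borel_measurable T"
    using meas by (subst measurable_cong_sets[OF _ refl])
  have "0 \<le> C" using a by (simp add: C_def)
  have f_le: "f \<theta> \<le> C" for \<theta>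
  proof (cases "P (\<lambda>j. cis (\<theta> j)) = 0")
    case False
    have n2: "norm (1 + cis t) \<le> 2" "norm (1 - cis t) \<le> 2" "norm (cis t + cis u) \<le> 2" for t u
      using norm_triangle_ineq[of 1 "cis t"] norm_triangle_ineq4[of 1 "cis t"] norm_triangle_ineq[of "cis t" "cis u"] by auto
    have "norm ((1 + cis (\<theta> 0)) * (1 + cis (\<theta> 1))) \<le> 2 * 2"
      unfolding norm_mult by (intro mult_mono n2) auto
    moreover have "norm (of_real a * (1 - cis (\<theta> 0)) * (cis (\<theta> 2) + cis (\<theta> 3))) \<le> a * 2 * 2"
      unfolding norm_mult using a by (intro mult_mono n2) auto
    ultimately have "norm (P (\<lambda>j. cis (\<theta> j))) \<le> 4 + 4 * a"
      unfolding P_def by (intro order_trans[OF norm_triangle_ineq]) auto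
    then show ?thesis
      unfolding f_def C_def using False a by (subst ln_le_cancel_iff) auto
  qed (use \<open>0 \<le> C\<close> in \<open>simp add: f_def\<close>)
  let ?N = "\<integral>\<^sup>+\<theta>. ennreal (C - f \<theta>) \<partial>T"
  have "?N = (\<integral>\<^sup>+w. \<integral>\<^sup>+x. \<integral>\<^sup>+y. \<integral>\<^sup>+z. ennreal (C - ln (norm ((1 + cis w) * (1 + cis x) + of_real a * (1 - cis w) * (cis y + cis z))))
            \<partial>circle \<partial>circle \<partial>circle \<partial>circle)"
    unfolding T_def f_def P_def by (rule nn_integral_PiM_seg_4) measurable
  then have N: "?N + ennreal (128 * pi * mahler_integrals a) = ennreal ((2 * pi) ^ 4 * C)"
    using nn_integral_mahler_defect[OF a C_def] by simp
  then have "?N \<noteq> top"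
    by (metis ennreal_add_eq_top ennreal_neq_top)
  then obtain n where n: "?N = ennreal n" "0 \<le> n"
    by (metis ennreal_cases)
  then have n_eq: "n = (2 * pi) ^ 4 * C - 128 * pi * mahler_integrals a"
    using N mahler_integrals_nonneg[OF a] \<open>0 \<le> C\<close> by (simp flip: ennreal_plus)
  have "has_bochner_integral T (\<lambda>\<theta>. C - f \<theta>) n"
    using n f_le by (intro has_bochner_integral_nn_integral) auto
  then have int: "integrable T (\<lambda>\<theta>. C - f \<theta>)" "(\<integral>\<theta>. C - f \<theta> \<partial>T) = n"
    by (auto simp: has_bochner_integral_iff)
  have "(\<integral>\<theta>. f \<theta> \<partial>T) = (\<integral>\<theta>. C - (C - f \<theta>) \<partial>T)"
    by simp
  also have "\<dots> = measure T (space T) * C - n"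
    using int by (subst Bochner_Integration.integral_diff) auto
  also have "measure T (space T) = (2 * pi) ^ 4"
    unfolding measure_def T_def by (simp add: segs.emeasure_PiM space_PiM emeasure_seg_UNIV ennreal_power)
  finally have "(\<integral>\<theta>. f \<theta> \<partial>T) = 128 * pi * mahler_integrals a"
    by (simp add: n_eq)
  moreover have "mahler_measure 4 P = 1 / (2 * pi) ^ 4 * (\<integral>\<theta>. f \<theta> \<partial>T)"
    using meas unfolding f_def T_def by (rule mahler_measure_eq_integral)
  ultimately have "pi ^ 3 * mahler_measure 4 P = 8 * mahler_integrals a"
    by (simp add: power_mult_distrib power4_eq_xxxx power3_eq_cube)
  then show ?thesis
    by (simp add: P_def[abs_def] Let_def)
qed

section \<open>Iterated integrals and polylogarithms\<close>

text \<open>Agreement off a countable set forces equal integrals also when neither function is known to be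
  measurable, as is the case for the inner layers of an iterated integral.\<close>
lemma LBINT_cong_countable:
  fixes f g :: "real \<Rightarrow> 'a :: {banach, second_countable_topology}"
  assumes "countable N" and "\<And>x. a \<le> x \<Longrightarrow> x \<le> b \<Longrightarrow> x \<notin> N \<Longrightarrow> f x = g x"
  shows "(LBINT x:{a..b}. f x) = (LBINT x:{a..b}. g x)"
  unfolding set_lebesgue_integral_def
  using assms by (intro integral_discrete_difference[of N]) (auto simp: indicator_def)

text \<open>Termwise integration up to \<open>s = 1\<close>, where the series itself may diverge at the end point.\<close>
lemma LBINT_power_series:
  fixes c :: "nat \<Rightarrow> complex"
  assumes c: "c 0 = 0" "\<And>n. norm (c n) \<le> 1" and s: "0 \<le> s" "s \<le> 1"
    and summable: "summable (\<lambda>n. norm (c n) * s ^ n / real n)"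
  shows "(LBINT r:{0..s}. \<Sum>n. c n * of_real r ^ (n - 1)) = (\<Sum>n. c n * of_real s ^ n / of_nat n)"
proof -
  define g where "g n r = r ^ (n - 1) * indicator {0..s} r" for n and r :: real
  define f where "f n r = c n * of_real (g n r)" for n r
  have g: "integrable lborel (g n)" for n
    using set_integrable_bounded_Icc[of "\<lambda>r. r ^ (n - 1)" 0 s 1] s
    by (auto simp: set_integrable_def g_def[abs_def] mult.commute power_le_one)
  have g_int: "(\<integral>r. g n r \<partial>lborel) = s ^ n / real n" if "n \<noteq> 0" for n
    using integral_power[of 0 s "n - 1"] s that by (simp add: g_def)
  have norm_f: "norm (f n r) = norm (c n) * g n r" for n r
    by (auto simp: f_def norm_mult norm_power g_def indicator_def)
  have "(\<lambda>n. \<integral>r. f n r \<partial>lborel) sums (\<integral>r. (\<Sum>n. f n r) \<partial>lborel)"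
  proof (rule sums_integral)
    show "integrable lborel (f n)" for n
      unfolding f_def[abs_def] using g by (intro integrable_mult_right integrable_of_real)
    show "AE r in lborel. summable (\<lambda>n. norm (f n r))"
      using AE_lborel_singleton[of 1]
    proof eventually_elim
      fix r :: real assume "r \<noteq> 1"
      show "summable (\<lambda>n. norm (f n r))"
      proof (cases "r \<in> {0..s}")
        case True
        then have r: "0 \<le> r" "r < 1" using s \<open>r \<noteq> 1\<close> by auto
        have "summable (\<lambda>n. norm (f (Suc n) r))"
        proof (rule summable_comparison_test'[OF summable_geometric[of r], of 0])
          show "norm (norm (f (Suc n) r)) \<le> r ^ n" for n
            using c(2)[of "Suc n"] r True by (simp add: norm_f g_def mult_left_le_one_le)
        qed (use r in auto)
        then show ?thesis by (subst (asm) summable_Suc_iff)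
      qed (simp add: norm_f g_def)
    qed
    have "(\<integral>r. norm (f n r) \<partial>lborel) = norm (c n) * s ^ n / real n" for n
      unfolding norm_f using g_int[of n] c(1) by (cases "n = 0") auto
    then show "summable (\<lambda>n. \<integral>r. norm (f n r) \<partial>lborel)"
      using summable by simp
  qed
  moreover have "(\<integral>r. f n r \<partial>lborel) = c n * of_real s ^ n / of_nat n" for n
    unfolding f_def using g_int[of n] c(1) by (cases "n = 0") auto
  moreover have "(\<integral>r. (\<Sum>n. f n r) \<partial>lborel) = (LBINT r:{0..s}. \<Sum>n. c n * of_real r ^ (n - 1))"
    unfolding set_lebesgue_integral_def f_def g_def
    by (intro Bochner_Integration.integral_cong) (auto simp: indicator_def)
  ultimately show ?thesis
    by (simp add: sums_unique)
qed

text \<open>The term with \<open>n = 0\<close> vanishes for \<open>p > 0\<close> because \<open>1 / 0 = 0\<close>.\<close>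
definition polylog :: "nat \<Rightarrow> complex \<Rightarrow> complex" where
  "polylog p z = (\<Sum>n. z ^ n / of_nat n ^ p)"

lemma norm_mult_of_real_less_1:
  fixes x :: complex
  assumes "norm x \<le> 1" "0 \<le> r" "r < 1"
  shows "norm (x * of_real r) < 1"
  using mult_right_mono[OF assms(1,2)] assms by (simp add: norm_mult)

lemma summable_polylog:
  fixes z :: complex
  assumes "norm z \<le> 1" "1 \<le> p" "norm z < 1 \<or> 2 \<le> p"
  shows "summable (\<lambda>n. norm (z ^ n / of_nat n ^ p))"
proof (cases "2 \<le> p")
  case True
  show ?thesis
    by (rule summable_comparison_test'[OF summable_inverse_powers[OF True], of 0])
       (auto simp: norm_divide norm_power intro!: divide_right_mono power_le_one assms)
next
  case False
  have "norm z ^ n / real n ^ p \<le> norm z ^ n" for n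
    using assms(2) mult_left_mono[of 1 "real n ^ p" "norm z ^ n"]
    by (cases "n = 0") (auto simp: divide_le_eq one_le_power power_0_left)
  then show ?thesis
    by (intro summable_comparison_test'[OF summable_geometric[of "norm z"], of 0])
       (use False assms in \<open>auto simp: norm_divide norm_power\<close>)
qed

lemma norm_polylog_le: "norm z \<le> 1 \<Longrightarrow> 2 \<le> p \<Longrightarrow> norm (polylog p z) \<le> (\<Sum>n. 1 / real n ^ p)"
proof -
  assume z: "norm z \<le> 1" and p: "2 \<le> p"
  then have sm: "summable (\<lambda>n. norm (z ^ n / of_nat n ^ p))"
    by (intro summable_polylog) auto
  have "norm (polylog p z) \<le> (\<Sum>n. norm (z ^ n / of_nat n ^ p))"
    unfolding polylog_def by (rule summable_norm[OF sm])
  also have "\<dots> \<le> (\<Sum>n. 1 / real n ^ p)"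
    using z by (intro suminf_le sm summable_inverse_powers p)
      (simp add: norm_divide norm_power divide_right_mono power_le_one)
  finally show ?thesis .
qed

text \<open>Integration against \<open>dr / r\<close> raises the index of the polylogarithm.\<close>
lemma LBINT_polylog:
  assumes x: "norm x \<le> 1" and s: "0 \<le> s" "s \<le> 1" and p: "1 \<le> p"
  shows "(LBINT r:{0..s}. 1 / of_real r * polylog p (x * of_real r)) = polylog (p + 1) (x * of_real s)"
proof -
  define c where "c n = x ^ n / of_nat n ^ p" for n
  have c0: "c 0 = 0" using p by (simp add: c_def power_0_left)
  have c1: "norm (c n) \<le> 1" for n
  proof (cases "n = 0")
    case False
    have "norm x ^ n \<le> 1"
      using x by (simp add: power_le_one)
    also have "1 \<le> real n ^ p"
      using False by (simp add: one_le_power)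
    finally show ?thesis
      using False by (simp add: c_def norm_divide norm_power divide_le_eq_1)
  qed (simp add: c0)
  have eq: "norm (c n) * s ^ n / real n = norm ((x * of_real s) ^ n / of_nat n ^ (p + 1))" for n
    using s by (simp add: c_def norm_divide norm_mult norm_power power_mult_distrib mult_ac)
  have "norm (x * of_real s) \<le> 1"
    using x s mult_mono[of "norm x" 1 s 1] by (simp add: norm_mult)
  then have sm: "summable (\<lambda>n. norm (c n) * s ^ n / real n)"
    unfolding eq using p by (intro summable_polylog) auto
  have "(LBINT r:{0..s}. 1 / of_real r * polylog p (x * of_real r)) = (LBINT r:{0..s}. \<Sum>n. c n * of_real r ^ (n - 1))"
  proof (rule LBINT_cong_countable[of "{0, 1}"])
    fix r assume "0 \<le> r" "r \<le> s" "r \<notin> {0, 1}"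
    then have r: "0 < r" "r < 1" using s by auto
    have "norm (x * of_real r) < 1"
      using x r by (intro norm_mult_of_real_less_1) auto
    then have "summable (\<lambda>n. (x * of_real r) ^ n / of_nat n ^ p)"
      using p by (intro summable_norm_cancel[OF summable_polylog]) auto
    from suminf_mult[OF this, of "1 / of_real r"]
    have "1 / of_real r * polylog p (x * of_real r) = (\<Sum>n. 1 / of_real r * ((x * of_real r) ^ n / of_nat n ^ p))"
      by (simp add: polylog_def)
    also have "\<dots> = (\<Sum>n. c n * of_real r ^ (n - 1))"
    proof (intro arg_cong[where f = suminf] ext)
      show "1 / of_real r * ((x * of_real r) ^ n / of_nat n ^ p) = c n * of_real r ^ (n - 1)" for n
        using r p by (cases n) (auto simp: c_def power_mult_distrib power_0_left)
    qed
    finally show "1 / of_real r * polylog p (x * of_real r) = (\<Sum>n. c n * of_real r ^ (n - 1))" .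
  qed simp
  also have "\<dots> = (\<Sum>n. c n * of_real s ^ n / of_nat n)"
    by (rule LBINT_power_series[OF c0 c1 s sm])
  also have "\<dots> = polylog (p + 1) (x * of_real s)"
    unfolding polylog_def by (intro arg_cong[where f = suminf] ext) (simp add: c_def power_mult_distrib)
  finally show ?thesis .
qed

text \<open>The innermost layer; \<open>s < 1\<close> keeps the path away from the pole \<open>1 / x\<close>.  The single value \<open>s = 1\<close>,
  where the integral may fail to exist, is ignored by the next layer.\<close>
lemma LBINT_simple_pole:
  assumes x: "norm x \<le> 1" "x \<noteq> 0" and s: "0 \<le> s" "s < 1"
  shows "(LBINT q:{0..s}. 1 / (of_real q - inverse x)) = - polylog 1 (x * of_real s)"
proof -
  define c where "c n = (if n = 0 then 0 else - (x ^ n))" for n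
  have c1: "norm (c n) \<le> 1" for n
    using x by (simp add: c_def norm_power power_le_one)
  have sm: "summable (\<lambda>n. norm (c n) * s ^ n / real n)"
  proof (rule summable_comparison_test'[OF summable_geometric[of s], of 0])
    show "norm (norm (c n) * s ^ n / real n) \<le> s ^ n" for n
    proof (cases "n = 0")
      case False
      have "norm (c n) * s ^ n \<le> s ^ n * 1"
        using c1[of n] s by (simp add: mult_left_le_one_le)
      also have "\<dots> \<le> s ^ n * real n"
        using False s by (intro mult_left_mono) auto
      finally show ?thesis
        using False s by (simp add: divide_le_eq)
    qed (simp add: c_def)
  qed (use s in auto)
  have "(LBINT q:{0..s}. 1 / (of_real q - inverse x)) = (LBINT r:{0..s}. \<Sum>n. c n * of_real r ^ (n - 1))"
  proof (rule LBINT_cong_countable[of "{}"])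
    fix r assume "0 \<le> r" "r \<le> s"
    then have "norm (x * of_real r) < 1"
      using x s by (intro norm_mult_of_real_less_1) auto
    then have "(\<lambda>n. - x * (x * of_real r) ^ n) sums (- x * (1 / (1 - x * of_real r)))"
      by (intro sums_mult geometric_sums)
    then have "(\<lambda>n. c (Suc n) * of_real r ^ (Suc n - 1)) sums (- x * (1 / (1 - x * of_real r)))"
      by (simp add: c_def power_mult_distrib mult_ac)
    then have "(\<lambda>n. c n * of_real r ^ (n - 1)) sums (- x * (1 / (1 - x * of_real r)) + c 0 * of_real r ^ (0 - 1))"
      by (subst (asm) sums_Suc_iff) (simp add: c_def)
    then have "(\<Sum>n. c n * of_real r ^ (n - 1)) = - x * (1 / (1 - x * of_real r))"
      by (simp add: sums_iff c_def)
    also have "1 - x * of_real r \<noteq> 0"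
      using \<open>norm (x * of_real r) < 1\<close> by auto
    then have "- x * (1 / (1 - x * of_real r)) = 1 / (of_real r - inverse x)"
      using x by (simp add: divide_simps) (simp add: algebra_simps)
    finally show "1 / (of_real r - inverse x) = (\<Sum>n. c n * of_real r ^ (n - 1))" ..
  qed simp
  also have "\<dots> = (\<Sum>n. c n * of_real s ^ n / of_nat n)"
    using s by (intro LBINT_power_series c1 sm) (auto simp: c_def)
  also have "\<dots> = (\<Sum>n. - ((x * of_real s) ^ n / of_nat n ^ 1))"
    by (intro arg_cong[where f = suminf] ext) (simp add: c_def power_mult_distrib)
  also have "\<dots> = - polylog 1 (x * of_real s)"
  proof -
    have "norm (x * of_real s) < 1"
      using x s by (intro norm_mult_of_real_less_1) auto
    then show ?thesis
      unfolding polylog_def by (intro suminf_minus summable_norm_cancel[OF summable_polylog]) auto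
  qed
  finally show ?thesis .
qed

lemma LBINT_uminus:
  fixes f :: "real \<Rightarrow> complex"
  shows "(LBINT r:{a..b}. - f r) = - (LBINT r:{a..b}. f r)"
  unfolding set_lebesgue_integral_def by simp

lemma LBINT_dilog_layer:
  assumes x: "norm x \<le> 1" "x \<noteq> 0" and s: "0 \<le> s" "s \<le> 1"
  shows "(LBINT r:{0..s}. 1 / of_real r * (LBINT q:{0..r}. 1 / (of_real q - inverse x))) = - polylog 2 (x * of_real s)"
proof -
  have "(LBINT r:{0..s}. 1 / of_real r * (LBINT q:{0..r}. 1 / (of_real q - inverse x)))
      = (LBINT r:{0..s}. - (1 / of_real r * polylog 1 (x * of_real r)))"
    \<comment> \<open>at \<open>r = 1\<close> the inner integral has a pole when \<open>x = 1\<close>\<close>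
  proof (rule LBINT_cong_countable[of "{1}"])
    fix r assume "0 \<le> r" "r \<le> s" "r \<notin> {1}"
    then have "0 \<le> r" "r < 1" using s by auto
    then show "1 / of_real r * (LBINT q:{0..r}. 1 / (of_real q - inverse x)) = - (1 / of_real r * polylog 1 (x * of_real r))"
      by (simp only: LBINT_simple_pole[OF x] mult_minus_right)
  qed simp
  also have "\<dots> = - polylog 2 (x * of_real s)"
    unfolding LBINT_uminus using LBINT_polylog[OF x(1) s, of 1] by (simp add: numeral_2_eq_2)
  finally show ?thesis .
qed

lemma LBINT_trilog_layer:
  assumes x: "norm x \<le> 1" "x \<noteq> 0" and s: "0 \<le> s" "s \<le> 1"
  shows "(LBINT u:{0..s}. 1 / of_real u * (LBINT r:{0..u}. 1 / of_real r * (LBINT q:{0..r}. 1 / (of_real q - inverse x))))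
     = - polylog 3 (x * of_real s)"
proof -
  have "(LBINT u:{0..s}. 1 / of_real u * (LBINT r:{0..u}. 1 / of_real r * (LBINT q:{0..r}. 1 / (of_real q - inverse x))))
      = (LBINT u:{0..s}. - (1 / of_real u * polylog 2 (x * of_real u)))"
  proof (rule LBINT_cong_countable[of "{}"])
    fix u assume "0 \<le> u" "u \<le> s"
    then have "0 \<le> u" "u \<le> 1" using s by auto
    then show "1 / of_real u * (LBINT r:{0..u}. 1 / of_real r * (LBINT q:{0..r}. 1 / (of_real q - inverse x)))
        = - (1 / of_real u * polylog 2 (x * of_real u))"
      by (simp only: LBINT_dilog_layer[OF x] mult_minus_right)
  qed simp
  also have "\<dots> = - polylog 3 (x * of_real s)"
    unfolding LBINT_uminus using LBINT_polylog[OF x(1) s, of 2] by simp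
  finally show ?thesis .
qed

lemma hyperlog_2: "hyperlog [2] [A] = (LBINT s:{0..1}. 1 / of_real s * (LBINT q:{0..s}. 1 / (of_real q - A)))"
  by (simp add: hyperlog_def hyperlog_forms_def iterated_integral_def)

lemma hyperlog_31:
  assumes "norm x \<le> 1" "x \<noteq> 0"
  shows "hyperlog [3, 1] [inverse x, B] = - (LBINT t:{0..1}. 1 / (of_real t - B) * polylog 3 (x * of_real t))"
proof -
  have "hyperlog [3, 1] [inverse x, B] = (LBINT t:{0..1}. 1 / (of_real t - B) *
     (LBINT u:{0..t}. 1 / of_real u * (LBINT r:{0..u}. 1 / of_real r * (LBINT q:{0..r}. 1 / (of_real q - inverse x)))))"
    by (simp add: hyperlog_def hyperlog_forms_def iterated_integral_def numeral_2_eq_2 numeral_3_eq_3)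
  also have "\<dots> = (LBINT t:{0..1}. - (1 / (of_real t - B) * polylog 3 (x * of_real t)))"
    by (intro LBINT_cong_countable[of "{}"]) (simp_all only: LBINT_trilog_layer[OF assms] mult_minus_right countable_empty)
  finally show ?thesis
    by (simp only: LBINT_uminus)
qed

text \<open>On the unit disc the defining series agrees with the iterated integral, so that small and large
  \<open>a\<close> can be treated together.\<close>
lemma multi_polylog_2:
  assumes "x \<noteq> 0"
  shows "multi_polylog [2] [x] = - hyperlog [2] [inverse x]"
proof (cases "norm x < 1")
  case True
  have sm: "summable (\<lambda>k. norm (x ^ k / of_nat k ^ 2))"
    using True by (intro summable_polylog) auto
  have set: "{ks :: nat list. length ks = length [2::nat] \<and> sorted_wrt (<) ks \<and> (\<forall>k\<in>set ks. 0 < k)} = (\<lambda>k. [k]) ` {0<..}"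
    by (auto simp: length_Suc_conv image_iff)
  have "multi_polylog [2] [x] = (\<Sum>\<^sub>\<infinity>ks\<in>(\<lambda>k. [k]) ` {0<..}. x ^ (ks ! 0) / of_nat (ks ! 0) ^ 2)"
    unfolding multi_polylog_def set using True by (simp add: lessThan_Suc)
  also have "\<dots> = (\<Sum>\<^sub>\<infinity>k\<in>{0<..}. x ^ k / of_nat k ^ 2)"
    by (subst infsum_reindex) (auto simp: inj_on_def o_def)
  also have "\<dots> = (\<Sum>\<^sub>\<infinity>k. x ^ k / of_nat k ^ 2)"
    by (intro infsum_cong_neutral) auto
  also have "\<dots> = polylog 2 x"
    unfolding polylog_def
    by (intro infsumI norm_summable_imp_has_sum sm summable_sums summable_norm_cancel[OF sm])
  also have "\<dots> = - hyperlog [2] [inverse x]"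
    using LBINT_dilog_layer[of x 1] True assms by (simp add: hyperlog_2)
  finally show ?thesis .
next
  case False
  then show ?thesis by (simp add: multi_polylog_def)
qed

text \<open>Real and imaginary part of \<open>1 / (q \<plusminus> \<i> / a)\<close> have elementary antiderivatives.  The logarithm is
  the same for both signs and cancels in the difference of the two dilogarithms.\<close>
lemma LBINT_imaginary_pole:
  assumes a: "0 < a" and \<sigma>: "\<sigma> = 1 \<or> \<sigma> = -1" and t: "0 \<le> t"
  shows "(LBINT q:{0..t}. 1 / (of_real q - inverse (of_real \<sigma> * \<i> * of_real a)))
    = of_real (ln (1 + (a * t) ^ 2) / 2) - of_real \<sigma> * \<i> * of_real (arctan (a * t))"
proof -
  define F where "F q = complex_of_real (ln (1 + (a * q) ^ 2) / 2) - of_real \<sigma> * \<i> * of_real (arctan (a * q))" for q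
  define f where "f q = complex_of_real (a ^ 2 * q / (1 + (a * q) ^ 2)) - of_real \<sigma> * \<i> * of_real (a / (1 + (a * q) ^ 2))" for q
  have pos: "0 < 1 + (a * q) ^ 2" for q
    by (simp add: add_pos_nonneg)
  have f_eq: "1 / (of_real q - inverse (of_real \<sigma> * \<i> * of_real a)) = f q" for q
  proof -
    have "complex_of_real (1 + (a * q) ^ 2) \<noteq> 0"
      using pos[of q] by (metis less_irrefl of_real_eq_0_iff)
    have "of_real q - inverse (of_real \<sigma> * \<i> * of_real a) = of_real q + of_real \<sigma> * \<i> / of_real a"
      using \<sigma> a by (auto simp: field_simps)
    moreover have "(of_real q + of_real \<sigma> * \<i> / of_real a) * f q = 1"
    proof -
      have "f q = (of_real a ^ 2 * of_real q - of_real \<sigma> * \<i> * of_real a) / of_real (1 + (a * q) ^ 2)"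
        by (simp add: f_def diff_divide_distrib)
      moreover have "(of_real q + of_real \<sigma> * \<i> / of_real a) * (of_real a ^ 2 * of_real q - of_real \<sigma> * \<i> * of_real a)
          = complex_of_real (1 + (a * q) ^ 2)"
        using \<sigma> a by (auto simp: field_simps power2_eq_square)
      ultimately show ?thesis
        using \<open>complex_of_real (1 + (a * q) ^ 2) \<noteq> 0\<close> by simp
    qed
    ultimately show ?thesis
      by (simp add: nonzero_divide_eq_eq divide_eq_eq) (metis mult.commute mult_zero_left zero_neq_one)
  qed
  have "(LBINT q:{0..t}. f q) = F t - F 0"
    unfolding set_lebesgue_integral_def
  proof (rule integral_FTC_Icc[OF t])
    fix q :: real
    have "((\<lambda>q. ln (1 + (a * q) ^ 2) / 2) has_real_derivative a ^ 2 * q / (1 + (a * q) ^ 2)) (at q within {0..t})"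
      using pos[of q] by (auto intro!: derivative_eq_intros simp: power2_eq_square field_simps)
    moreover have "((\<lambda>q. arctan (a * q)) has_real_derivative a / (1 + (a * q) ^ 2)) (at q within {0..t})"
      using DERIV_arctan_scaled(2)[OF a] by (rule DERIV_subset) simp
    ultimately show "(F has_vector_derivative f q) (at q within {0..t})"
      unfolding F_def[abs_def] f_def
      by (intro has_vector_derivative_diff has_vector_derivative_mult_right has_vector_derivative_of_real)
         (simp_all only: has_real_derivative_iff_has_vector_derivative)
  next
    show "continuous_on {0..t} f"
      unfolding f_def[abs_def] using pos by (intro continuous_intros) (metis less_irrefl)+
  qed
  then show ?thesis
    by (simp only: f_eq) (simp add: F_def)
qed

lemma polylog_diff_2:
  assumes a: "0 < a"
  shows "polylog_diff a 2 \<i> = 2 * \<i> * of_real (LBINT s:{0..1}. arctan (a * s) / s)"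
proof -
  define u where "u \<sigma> s = of_real (ln (1 + (a * s) ^ 2) / 2) - of_real \<sigma> * \<i> * of_real (arctan (a * s))" for \<sigma> s
  have hyp: "hyperlog [2] [inverse (of_real \<sigma> * \<i> * of_real a)] = (LBINT s:{0..1}. 1 / of_real s * u \<sigma> s)"
    if "\<sigma> = 1 \<or> \<sigma> = -1" for \<sigma>
    unfolding hyperlog_2 u_def
    by (intro LBINT_cong_countable[of "{}"]) (simp_all only: LBINT_imaginary_pole[OF a that] countable_empty)
  have int: "set_integrable lborel {0..1} (\<lambda>s. 1 / of_real s * u \<sigma> s)" if "\<sigma> = 1 \<or> \<sigma> = -1" for \<sigma>
  proof (rule set_integrable_bounded_Icc[where K = "a ^ 2 + a"])
    show "(\<lambda>s. 1 / complex_of_real s * u \<sigma> s) \<in> borel_measurable borel"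
      unfolding u_def by measurable
    fix s :: real assume s: "0 \<le> s" "s \<le> 1"
    have "0 \<le> ln (1 + (a * s) ^ 2)" "ln (1 + (a * s) ^ 2) \<le> (a * s) ^ 2"
      by (simp_all add: ln_add_one_self_le_self)
    moreover have "0 \<le> arctan (a * s)" "arctan (a * s) \<le> a * s"
      using a s by (simp_all add: arctan_le_self)
    moreover have "norm (u \<sigma> s) \<le> \<bar>ln (1 + (a * s) ^ 2) / 2\<bar> + \<bar>arctan (a * s)\<bar>"
      unfolding u_def using that by (intro order_trans[OF norm_triangle_ineq4]) (auto simp: norm_mult)
    ultimately have "norm (u \<sigma> s) \<le> (a * s) ^ 2 + a * s"
      by (smt (verit) field_sum_of_halves)
    also have "\<dots> \<le> a ^ 2 * s + a * s"
      using mult_left_mono[OF mult_left_le[of s s], of "a ^ 2"] s by (simp add: power2_eq_square mult_ac)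
    finally have "norm (u \<sigma> s) \<le> (a ^ 2 + a) * s"
      by (simp add: algebra_simps)
    then show "norm (1 / complex_of_real s * u \<sigma> s) \<le> a ^ 2 + a"
      using s a by (cases "s = 0") (auto simp: norm_mult norm_divide divide_le_eq)
  qed
  have "polylog_diff a 2 \<i> = - hyperlog [2] [inverse (of_real 1 * \<i> * of_real a)] + hyperlog [2] [inverse (of_real (-1) * \<i> * of_real a)]"
    using a by (simp add: polylog_diff_def multi_polylog_2)
  also have "\<dots> = (LBINT s:{0..1}. 1 / of_real s * u (-1) s) - (LBINT s:{0..1}. 1 / of_real s * u 1 s)"
    by (simp only: hyp simp_thms) simp
  also have "\<dots> = (LBINT s:{0..1}. 1 / of_real s * u (-1) s - 1 / of_real s * u 1 s)"
    by (intro set_integral_diff(2)[symmetric] int) auto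
  also have "\<dots> = (LBINT s:{0..1}. 2 * \<i> * of_real (arctan (a * s) / s))"
    by (intro LBINT_cong_countable[of "{}"]) (simp_all add: u_def flip: right_diff_distrib diff_divide_distrib)
  also have "\<dots> = 2 * \<i> * of_real (LBINT s:{0..1}. arctan (a * s) / s)"
    by (simp only: set_integral_mult_right set_integral_complex_of_real)
  finally show ?thesis .
qed

lemma polylog_minus: "0 \<le> t \<Longrightarrow> t \<le> 1 \<Longrightarrow> 2 \<le> p \<Longrightarrow>
    polylog p (of_real t) - polylog p (- of_real t) = 2 * of_real (legendre_chi p t)"
proof -
  assume t: "0 \<le> t" "t \<le> 1" and p: "2 \<le> p"
  have s: "summable (\<lambda>n. complex_of_real t ^ n / of_nat n ^ p)" "summable (\<lambda>n. (- complex_of_real t) ^ n / of_nat n ^ p)"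
    using t p by (intro summable_norm_cancel[OF summable_polylog]; simp)+
  have "polylog p (of_real t) - polylog p (- of_real t)
     = (\<Sum>n. complex_of_real t ^ n / of_nat n ^ p - (- complex_of_real t) ^ n / of_nat n ^ p)"
    unfolding polylog_def by (rule suminf_diff[OF s])
  also have "\<dots> = (\<Sum>n. 2 * complex_of_real (of_bool (odd n) * t ^ n / real n ^ p))"
    by (intro arg_cong[where f = suminf] ext) (auto simp: power_minus_odd)
  also have "\<dots> = 2 * (\<Sum>n. complex_of_real (of_bool (odd n) * t ^ n / real n ^ p))"
    using t p by (intro suminf_mult summable_of_real summable_chi) auto
  also have "(\<Sum>n. complex_of_real (of_bool (odd n) * t ^ n / real n ^ p)) = of_real (legendre_chi p t)"
    unfolding legendre_chi_def using t p by (intro suminf_of_real[symmetric] summable_chi) auto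
  finally show ?thesis .
qed

lemma borel_measurable_polylog [measurable]: "polylog p \<in> borel_measurable borel"
  unfolding polylog_def[abs_def] by measurable

lemma set_integrable_polylog_31:
  assumes b: "0 < b" and \<beta>: "\<beta> = \<i> * of_real b \<or> \<beta> = - \<i> * of_real b" and x: "norm x \<le> 1"
  shows "set_integrable lborel {0..1} (\<lambda>t. 1 / (of_real t - \<beta>) * polylog 3 (x * of_real t))"
proof (rule set_integrable_bounded_Icc[where K = "1 / b * (\<Sum>n. 1 / real n ^ 3)"])
  fix t :: real assume t: "0 \<le> t" "t \<le> 1"
  have "b \<le> norm (of_real t - \<beta>)"
    using abs_Im_le_cmod[of "of_real t - \<beta>"] \<beta> b by auto
  then have "norm (1 / (of_real t - \<beta>)) \<le> 1 / b"
    using b by (simp add: norm_divide frac_le)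
  moreover have "norm (polylog 3 (x * of_real t)) \<le> (\<Sum>n. 1 / real n ^ 3)"
    using t x mult_mono[of "norm x" 1 t 1] by (intro norm_polylog_le) (auto simp: norm_mult)
  ultimately show "norm (1 / (of_real t - \<beta>) * polylog 3 (x * of_real t)) \<le> 1 / b * (\<Sum>n. 1 / real n ^ 3)"
    unfolding norm_mult using b by (intro mult_mono) auto
qed measurable

text \<open>The products \<open>x y\<close> of the four arguments are \<open>\<plusminus>1\<close>, so the three inner layers give \<open>Li\<^sub>3 (\<plusminus> t)\<close> and
  combine to \<open>2 \<chi>\<^sub>3(t)\<close>; the two outermost forms combine to
  \<open>1 / (t + \<i> b) - 1 / (t - \<i> b) = - 2 \<i> b / (t\<^sup>2 + b\<^sup>2)\<close>.\<close>
lemma polylog_S_31: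
  assumes b: "0 < b"
  shows "polylog_S 3 1 b \<i> \<i> = - 4 * \<i> * of_real (LBINT t:{0..1}. legendre_chi 3 t * (b / (b ^ 2 + t ^ 2)))"
proof -
  let ?\<beta> = "\<i> * of_real b"
  define J where "J x \<beta> = (LBINT t:{0..1}. 1 / (of_real t - \<beta>) * polylog 3 (x * of_real t))" for x \<beta>
  have Li: "multi_polylog [3, 1] [X, Y] = - J x \<beta>"
    if "\<not> norm X < 1 \<or> \<not> norm Y < 1" "X * Y = x" "inverse Y = \<beta>" "norm x \<le> 1" "x \<noteq> 0" for X Y x \<beta>
    using that hyperlog_31[of x \<beta>] by (auto simp: multi_polylog_def J_def)
  \<comment> \<open>no choice of \<open>b\<close> puts both arguments into the open unit disc, so the iterated integral is always used\<close>
  have big: "\<not> norm X < 1 \<or> \<not> norm Y < 1" if "norm X = b" "norm Y = 1 / b" for X Y :: complex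
    using b that by (auto simp: divide_less_eq)
  have Li_b: "multi_polylog [3, 1] [of_real b * \<i>, \<i> / of_real b] = - J (-1) (- ?\<beta>)"
    "multi_polylog [3, 1] [- of_real b * \<i>, \<i> / of_real b] = - J 1 (- ?\<beta>)"
    "multi_polylog [3, 1] [of_real b * \<i>, - \<i> / of_real b] = - J 1 ?\<beta>"
    "multi_polylog [3, 1] [- of_real b * \<i>, - \<i> / of_real b] = - J (-1) ?\<beta>"
    using b by (intro Li big; simp add: norm_mult norm_divide field_simps)+
  define \<phi> where "\<phi> \<beta> t = 1 / (of_real t - \<beta>) * polylog 3 (1 * of_real t) - 1 / (of_real t - \<beta>) * polylog 3 (-1 * of_real t)"
    for \<beta> t
  have J_diff: "set_integrable lborel {0..1} (\<phi> \<beta>)" "J 1 \<beta> - J (-1) \<beta> = (LBINT t:{0..1}. \<phi> \<beta> t)"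
    if "\<beta> = ?\<beta> \<or> \<beta> = - ?\<beta>" for \<beta>
  proof -
    have "set_integrable lborel {0..1} (\<lambda>t. 1 / (of_real t - \<beta>) * polylog 3 (x * of_real t))" if "norm x \<le> 1" for x
      using \<open>\<beta> = ?\<beta> \<or> \<beta> = - ?\<beta>\<close> b that by (intro set_integrable_polylog_31) auto
    from set_integral_diff[OF this[of 1] this[of "-1"]]
    show "set_integrable lborel {0..1} (\<phi> \<beta>)" "J 1 \<beta> - J (-1) \<beta> = (LBINT t:{0..1}. \<phi> \<beta> t)"
      unfolding \<phi>_def[abs_def] J_def by simp_all
  qed
  have "polylog_S 3 1 b \<i> \<i> = (J 1 (- ?\<beta>) - J (-1) (- ?\<beta>)) - (J 1 ?\<beta> - J (-1) ?\<beta>)"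
    unfolding polylog_S_def Li_b by simp
  also have "\<dots> = (LBINT t:{0..1}. \<phi> (- ?\<beta>) t - \<phi> ?\<beta> t)"
    using J_diff by simp
  also have "\<dots> = (LBINT t:{0..1}. - 4 * \<i> * of_real (legendre_chi 3 t * (b / (b ^ 2 + t ^ 2))))"
  proof (rule LBINT_cong_countable[of "{}"])
    fix t :: real assume t: "0 \<le> t" "t \<le> 1"
    have \<phi>: "\<phi> \<beta> t = 1 / (of_real t - \<beta>) * (2 * of_real (legendre_chi 3 t))" for \<beta>
      using polylog_minus[OF t, of 3] by (simp add: \<phi>_def flip: right_diff_distrib diff_divide_distrib)
    have "0 < b ^ 2 + t ^ 2"
      using b by (simp add: add_pos_nonneg)
    then have nz: "complex_of_real (b ^ 2 + t ^ 2) \<noteq> 0"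
      by (metis less_irrefl of_real_eq_0_iff)
    have prod: "(of_real t + ?\<beta>) * (of_real t - ?\<beta>) = complex_of_real (b ^ 2 + t ^ 2)"
      by (simp add: algebra_simps power2_eq_square)
    then have "of_real t + ?\<beta> \<noteq> 0" "of_real t - ?\<beta> \<noteq> 0"
      using nz by auto
    then have "1 / (of_real t - - ?\<beta>) - 1 / (of_real t - ?\<beta>) = - 2 * ?\<beta> / ((of_real t + ?\<beta>) * (of_real t - ?\<beta>))"
      by (simp add: diff_frac_eq)
    then have "1 / (of_real t - - ?\<beta>) - 1 / (of_real t - ?\<beta>) = - 2 * \<i> * of_real (b / (b ^ 2 + t ^ 2))"
      unfolding prod by simp
    then show "\<phi> (- ?\<beta>) t - \<phi> ?\<beta> t = - 4 * \<i> * of_real (legendre_chi 3 t * (b / (b ^ 2 + t ^ 2)))"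
      unfolding \<phi> left_diff_distrib[symmetric] by simp
  qed simp
  also have "\<dots> = - 4 * \<i> * of_real (LBINT t:{0..1}. legendre_chi 3 t * (b / (b ^ 2 + t ^ 2)))"
    by (simp only: set_integral_mult_right set_integral_complex_of_real)
  finally show ?thesis .
qed

theorem theorem18:
  fixes a :: real
  assumes "a > 0"
  shows "of_real (pi ^ 3 * mahler_measure 4 (\<lambda>X.
             let w = X 0; x = X 1; y = X 2; z = X 3
             in (1 + w) * (1 + x) + of_real a * (1 - w) * (y + z)))
         = - \<i> * of_real (pi ^ 2) * polylog_diff a 2 \<i> + 2 * \<i> * polylog_diff2 a 3 1 \<i> \<i>"
proof -
  have "1 / a / ((1 / a) ^ 2 + t ^ 2) = a / (1 + (a * t) ^ 2)" for t
  proof -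
    have "(1 / a) ^ 2 + t ^ 2 = (1 + (a * t) ^ 2) / a ^ 2"
      using assms by (simp add: field_simps)
    then show ?thesis
      using assms by (simp add: power2_eq_square)
  qed
  then have "polylog_S 3 1 (1 / a) \<i> \<i> = - 4 * \<i> * of_real (LBINT t:{0..1}. legendre_chi 3 t * (a / (1 + (a * t) ^ 2)))"
    using polylog_S_31[of "1 / a"] assms by simp
  then show ?thesis
    unfolding mahler_measure_eq_integrals[OF assms] polylog_diff_2[OF assms] polylog_diff2_def polylog_S_31[OF assms] mahler_integrals_def
    by (simp add: algebra_simps)
qed

end
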